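(* Suppose $\mu=0$ (i.e. $\psi$ is only assumed convex), $T\ge n$, and the iterates $\boldsymbol{x}_1,\dots,\boldsymbol{x}_{T+1}$ are produced by the General Proximal Gradient Method under the Random Reshuffle ($\mathsf{RR}$) sampling scheme. Let $\boldsymbol{x}_{T+1}^{\mathsf{suffix}}=\frac1n\sum_{t=T-n+1}^{T}\boldsymbol{x}_{t+1}$ and let $\eta>0$. (1) If $\eta_t=\eta$ for all $t\in[T]$, and additionally $T\ge 2(n-1)$, then for any $\boldsymbol{z}\in\mathbb{R}^d$, $$\mathbb{E}[F(\boldsymbol{x}_{T+1}^{\mathsf{suffix}})-F(\boldsymbol{z})]\le O\left(\frac{\|\boldsymbol{z}-\boldsymbol{x}_1\|^2}{\eta T}+\eta\sqrt{n}\,G_{f,1}G_{f,2}(1+\log T)\right).$$ (2) If $\eta_t=\frac{\eta}{\sqrt{t}}$ for all $t\in[T]$, then for any $\boldsymbol{z}\in\mathbb{R}^d$, $$\mathbb{E}[F(\boldsymbol{x}_{T+1}^{\mathsf{suffix}})-F(\boldsymbol{z})]\le O\left(\left(\frac{\|\boldsymbol{z}-\boldsymbol{x}_1\|^2}{\eta}+\eta\sqrt{n}\,G_{f,1}G_{f,2}(1+\log T)\right)\frac{1}{\sqrt{T}}\right).$$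
   Context: Notation: $\mathbb{N}=\{1,2,\dots\}$, $[m]=\{1,\dots,m\}$, $\|\cdot\|$ and $\langle\cdot,\cdot\rangle$ are the Euclidean norm and inner product on $\mathbb{R}^d$, $\overline{\mathbb{R}}=(-\infty,+\infty]$, $\mathrm{dom}\,h=\{\boldsymbol{x}:h(\boldsymbol{x})<+\infty\}$, $\partial h(\boldsymbol{x})$ is the convex subdifferential and $\nabla h(\boldsymbol{x})$ denotes an element of $\partial h(\boldsymbol{x})$. $O(\cdot)$ hides an absolute constant. Problem: $F=f+\psi$ with $f=\frac1n\sum_{i=1}^n f_i$, each $f_i:\mathbb{R}^d\to\mathbb{R}$ convex, and $\psi:\mathbb{R}^d\to\overline{\mathbb{R}}$ proper, closed and convex. Each $f_i$ is $G_i$-Lipschitz on $\mathrm{dom}\,\psi$ for some $G_i>0$. For every $i\in[n]$ and $\boldsymbol{x}\in\mathbb{R}^d$, $\nabla f_i(\boldsymbol{x})$ is deterministically picked from $\partial f_i(\boldsymbol{x})$. Put $G_{f,1}=\frac1n\sum_{i=1}^nG_i$ and $G_{f,2}=\sqrt{\frac1n\sum_{i=1}^nG_i^2}$. General Proximal Gradient Method: given $T\in\mathbb{N}$, an initial point $\boldsymbol{x}_1\in\mathrm{dom}\,\psi$ and stepsizes $\eta_t>0$, $t\in[T]$, for $t=1,\dots,T$ generate an index $\mathsf{i}(t)\in[n]$ and set $$\boldsymbol{x}_{t+1}=\mathrm{argmin}_{\boldsymbol{x}\in\mathbb{R}^d}\ \psi(\boldsymbol{x})+\langle\nabla f_{\mathsf{i}(t)}(\boldsymbol{x}_t),\boldsymbol{x}\rangle+\frac{\|\boldsymbol{x}-\boldsymbol{x}_t\|^2}{2\eta_t}.$$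 For $t\in\mathbb{N}$, $\mathsf{q}(t)=\lceil t/n\rceil$ and $\mathsf{r}(t)=t-(\mathsf{q}(t)-1)n\in[n]$. $\mathsf{RR}$ sampling scheme: $\mathsf{i}(t)=\pi_{\mathsf{q}(t)}^{\mathsf{r}(t)}$ where $\pi_1,\dots,\pi_{\mathsf{q}(T)}$ are mutually independent uniformly random permutations of $[n]$, and $\pi^j$ denotes the $j$-th entry of $\pi$.
   Formalization: "G_i-Lipschitz on dom ψ" also includes that the picked subgradients ∇f_i(x) at points x of dom ψ have norm at most G_i; with Lipschitz values alone the claim fails, e.g. f(x)=max(-Kx,x), ψ the indicator of [0,∞), x_1=z=0, ∇f(0)=-K. *)

theory Defs
  imports "HOL-Analysis.Analysis" "HOL-Probability.Probability" "HOL-Combinatorics.Permutations"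
begin

text \<open>
  The implied constant of the main bounds must not depend on the dimension \<open>d\<close>. A constant
  quantified outside of a statement about a type \<open>'a::euclidean_space\<close> could depend on
  that type, hence \<open>d\<close> has to be a variable. We therefore use one inner product space,
  the finitely supported real sequences with the Euclidean inner product, in which the
  \<open>d\<close>-dimensional Euclidean space is the subspace \<open>Rd d\<close> of the sequences vanishing from
  position \<open>d\<close> on. Norm, inner product, topology and convexity are then the library's.
\<close>

typedef seqvec = "{x :: nat \<Rightarrow> real. finite {i. x i \<noteq> 0}}"
  morphisms coord Abs_seqvec
  by (rule exI [of _ "\<lambda>_. 0"]) simp

setup_lifting type_definition_seqvec

lemma finite_coord [simp]: "finite {i. coord x i \<noteq> 0}"
  using coord [of x] by simp

lemma seqvec_eqI: "(\<And>i. coord x i = coord y i) \<Longrightarrow> x = y"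
  by (simp add: coord_inject [symmetric] fun_eq_iff)

instantiation seqvec :: real_vector
begin

lift_definition zero_seqvec :: seqvec is "\<lambda>_. 0" by simp

lift_definition plus_seqvec :: "seqvec \<Rightarrow> seqvec \<Rightarrow> seqvec" is "\<lambda>x y i. x i + y i"
  subgoal for x y by (rule finite_subset [of _ "{i. x i \<noteq> 0} \<union> {i. y i \<noteq> 0}"]) auto
  done

lift_definition minus_seqvec :: "seqvec \<Rightarrow> seqvec \<Rightarrow> seqvec" is "\<lambda>x y i. x i - y i"
  subgoal for x y by (rule finite_subset [of _ "{i. x i \<noteq> 0} \<union> {i. y i \<noteq> 0}"]) auto
  done

lift_definition uminus_seqvec :: "seqvec \<Rightarrow> seqvec" is "\<lambda>x i. - x i" by simp

lift_definition scaleR_seqvec :: "real \<Rightarrow> seqvec \<Rightarrow> seqvec" is "\<lambda>c x i. c * x i"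
  by (erule rev_finite_subset) auto

instance
  by standard (transfer; simp add: fun_eq_iff algebra_simps)+

end

lemma coord_simps [simp]:
  "coord 0 i = 0" "coord (x + y) i = coord x i + coord y i"
  "coord (x - y) i = coord x i - coord y i" "coord (- x) i = - coord x i"
  "coord (c *\<^sub>R x) i = c * coord x i"
  by (transfer; simp)+

lemma inner_sum_mono_seqvec:
  assumes "finite A" "{i. coord x i \<noteq> 0} \<subseteq> A"
  shows "(\<Sum>i | coord x i \<noteq> 0. coord x i * coord y i) = (\<Sum>i\<in>A. coord x i * coord y i)"
  using assms by (intro sum.mono_neutral_left) auto

instantiation seqvec :: real_inner
begin

definition inner_seqvec :: "seqvec \<Rightarrow> seqvec \<Rightarrow> real" where
  "inner_seqvec x y = (\<Sum>i | coord x i \<noteq> 0. coord x i * coord y i)"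

definition norm_seqvec :: "seqvec \<Rightarrow> real" where
  "norm_seqvec x = sqrt (inner x x)"

definition sgn_seqvec :: "seqvec \<Rightarrow> seqvec" where
  "sgn_seqvec x = x /\<^sub>R norm x"

definition dist_seqvec :: "seqvec \<Rightarrow> seqvec \<Rightarrow> real" where
  "dist_seqvec x y = norm (x - y)"

definition uniformity_seqvec :: "(seqvec \<times> seqvec) filter" where
  "uniformity_seqvec = (INF e\<in>{0<..}. principal {(x, y). dist x y < e})"

definition open_seqvec :: "seqvec set \<Rightarrow> bool" where
  "open_seqvec U \<longleftrightarrow>
     (\<forall>x\<in>U. eventually (\<lambda>(x', y). x' = x \<longrightarrow> y \<in> U) (uniformity :: (seqvec \<times> seqvec) filter))"

instance
proof
  fix x y z :: seqvec and r :: real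
  define A where "A = {i. coord x i \<noteq> 0} \<union> {i. coord y i \<noteq> 0}"
  have A: "finite A" "{i. coord x i \<noteq> 0} \<subseteq> A" "{i. coord y i \<noteq> 0} \<subseteq> A"
    "{i. coord (x + y) i \<noteq> 0} \<subseteq> A" "{i. coord (r *\<^sub>R x) i \<noteq> 0} \<subseteq> A"
    by (auto simp: A_def)
  note S = A(2-5) [THEN inner_sum_mono_seqvec [OF A(1)]]
  show "inner x y = inner y x"
    by (simp only: inner_seqvec_def S) (simp only: mult.commute)
  show "inner (x + y) z = inner x z + inner y z"
    by (simp only: inner_seqvec_def S) (simp add: sum.distrib algebra_simps)
  show "inner (r *\<^sub>R x) y = r * inner x y"
    by (simp only: inner_seqvec_def S) (simp add: sum_distrib_left algebra_simps)
  show "0 \<le> inner x x"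
    by (simp add: inner_seqvec_def sum_nonneg)
  show "inner x x = 0 \<longleftrightarrow> x = 0"
  proof
    assume "inner x x = 0"
    then have *: "\<forall>i\<in>{i. coord x i \<noteq> 0}. coord x i * coord x i = 0"
      unfolding inner_seqvec_def by (subst (asm) sum_nonneg_eq_0_iff) auto
    show "x = 0" by (rule seqvec_eqI) (use * in auto)
  qed (simp add: inner_seqvec_def)
qed (simp_all only: norm_seqvec_def sgn_seqvec_def dist_seqvec_def uniformity_seqvec_def
      open_seqvec_def)

end

definition Rd :: "nat \<Rightarrow> seqvec set" where
  "Rd d = {x. \<forall>i\<ge>d. coord x i = 0}"

lemma subspace_Rd: "subspace (Rd d)"
  by (auto simp: subspace_def Rd_def)

lemma inner_Rd: "x \<in> Rd d \<Longrightarrow> inner x y = (\<Sum>i<d. coord x i * coord y i)"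
  unfolding inner_seqvec_def Rd_def
  by (rule inner_sum_mono_seqvec) (auto simp: not_le [symmetric])

lemma norm_Rd: "x \<in> Rd d \<Longrightarrow> norm x = sqrt (\<Sum>i<d. (coord x i)\<^sup>2)"
  by (simp add: norm_seqvec_def inner_Rd power2_eq_square)

lemma ex1_Rd: "\<exists>!x. x \<in> Rd d \<and> (\<forall>i<d. coord x i = a i)"
proof
  have "finite {i. (if i < d then a i else 0) \<noteq> (0::real)}"
    by (rule finite_subset [of _ "{..<d}"]) auto
  then show "Abs_seqvec (\<lambda>i. if i < d then a i else 0) \<in> Rd d \<and>
      (\<forall>i<d. coord (Abs_seqvec (\<lambda>i. if i < d then a i else 0)) i = a i)"
    by (simp add: Rd_def Abs_seqvec_inverse)
next
  fix x assume "x \<in> Rd d \<and> (\<forall>i<d. coord x i = a i)"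
  then have "coord x = (\<lambda>i. if i < d then a i else 0)"
    by (auto simp: Rd_def fun_eq_iff)
  then show "x = Abs_seqvec (\<lambda>i. if i < d then a i else 0)"
    by (metis coord_inverse)
qed

definition eff_dom :: "nat \<Rightarrow> (seqvec \<Rightarrow> ereal) \<Rightarrow> seqvec set" where
  "eff_dom d h = {x \<in> Rd d. h x < \<infinity>}"

definition proper_fun :: "nat \<Rightarrow> (seqvec \<Rightarrow> ereal) \<Rightarrow> bool" where
  "proper_fun d h \<longleftrightarrow> (\<forall>x\<in>Rd d. h x \<noteq> -\<infinity>) \<and> eff_dom d h \<noteq> {}"

definition closed_fun :: "nat \<Rightarrow> (seqvec \<Rightarrow> ereal) \<Rightarrow> bool" where
  "closed_fun d h \<longleftrightarrow> closed {(x, r :: real). x \<in> Rd d \<and> h x \<le> ereal r}"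

definition convex_fun :: "nat \<Rightarrow> (seqvec \<Rightarrow> ereal) \<Rightarrow> bool" where
  "convex_fun d h \<longleftrightarrow> (\<forall>x\<in>Rd d. \<forall>y\<in>Rd d. \<forall>u. 0 < u \<and> u < 1 \<longrightarrow>
     h ((1 - u) *\<^sub>R x + u *\<^sub>R y) \<le> ereal (1 - u) * h x + ereal u * h y)"

definition subdiff :: "nat \<Rightarrow> (seqvec \<Rightarrow> real) \<Rightarrow> seqvec \<Rightarrow> seqvec set" where
  "subdiff d h x = {g \<in> Rd d. \<forall>y\<in>Rd d. h x + inner g (y - x) \<le> h y}"

text \<open>
  \<open>grad i x\<close> is the picked subgradient of \<open>f i\<close> at \<open>x\<close>. The condition that \<open>f i\<close> is
  \<open>G i\<close>-Lipschitz on \<open>dom \<psi>\<close> is used in the usual sense that also the subgradients at the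
  points of \<open>dom \<psi>\<close> are bounded by \<open>G i\<close>. In the interior of \<open>dom \<psi>\<close> this follows from the
  Lipschitz condition on the values of \<open>f i\<close>, but at other points it does not: with
  \<open>f(x) = max (-K * x) x\<close> and \<open>\<psi>\<close> the indicator function of the half line \<open>x \<ge> 0\<close>, the function
  \<open>f\<close> is 1-Lipschitz on \<open>dom \<psi>\<close>, while \<open>-K\<close> is a subgradient of \<open>f\<close> at 0.
\<close>

locale composite_problem =
  fixes d n :: nat
    and f :: "nat \<Rightarrow> seqvec \<Rightarrow> real"
    and \<psi> :: "seqvec \<Rightarrow> ereal"
    and G :: "nat \<Rightarrow> real"
    and grad :: "nat \<Rightarrow> seqvec \<Rightarrow> seqvec"
  assumes d_pos: "1 \<le> d"
    and n_pos: "1 \<le> n"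
    and f_convex: "\<And>i. i \<in> {1..n} \<Longrightarrow> convex_on (Rd d) (f i)"
    and psi_proper: "proper_fun d \<psi>"
    and psi_closed: "closed_fun d \<psi>"
    and psi_convex: "convex_fun d \<psi>"
    and G_pos: "\<And>i. i \<in> {1..n} \<Longrightarrow> 0 < G i"
    and f_lipschitz: "\<And>i. i \<in> {1..n} \<Longrightarrow> (G i)-lipschitz_on (eff_dom d \<psi>) (f i)"
    and grad_subdiff: "\<And>i x. i \<in> {1..n} \<Longrightarrow> x \<in> Rd d \<Longrightarrow> grad i x \<in> subdiff d (f i) x"
    and grad_bound: "\<And>i x. i \<in> {1..n} \<Longrightarrow> x \<in> eff_dom d \<psi> \<Longrightarrow> norm (grad i x) \<le> G i"

definition objective :: "nat \<Rightarrow> (nat \<Rightarrow> seqvec \<Rightarrow> real) \<Rightarrow> (seqvec \<Rightarrow> ereal) \<Rightarrow> seqvec \<Rightarrow> ereal" where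
  "objective n f \<psi> x = ereal ((\<Sum>i=1..n. f i x) / real n) + \<psi> x"

definition G1 :: "nat \<Rightarrow> (nat \<Rightarrow> real) \<Rightarrow> real" where
  "G1 n G = (\<Sum>i=1..n. G i) / real n"

definition G2 :: "nat \<Rightarrow> (nat \<Rightarrow> real) \<Rightarrow> real" where
  "G2 n G = sqrt ((\<Sum>i=1..n. (G i)\<^sup>2) / real n)"

definition prox_grad_iterates ::
  "nat \<Rightarrow> (seqvec \<Rightarrow> ereal) \<Rightarrow> (nat \<Rightarrow> seqvec \<Rightarrow> seqvec) \<Rightarrow> nat \<Rightarrow> (nat \<Rightarrow> real) \<Rightarrow> (nat \<Rightarrow> nat) \<Rightarrow>
     seqvec \<Rightarrow> (nat \<Rightarrow> seqvec) \<Rightarrow> bool" where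
  "prox_grad_iterates d \<psi> grad T \<eta> idx x1 x \<longleftrightarrow> x 1 = x1 \<and>
     (\<forall>t\<in>{1..T}. is_arg_min
        (\<lambda>y. \<psi> y + ereal (inner (grad (idx t) (x t)) y + (norm (y - x t))\<^sup>2 / (2 * \<eta> t)))
        (\<lambda>y. y \<in> Rd d) (x (t + 1)))"

definition epoch :: "nat \<Rightarrow> nat \<Rightarrow> nat" where
  "epoch n t = nat \<lceil>real t / real n\<rceil>"

definition epoch_pos :: "nat \<Rightarrow> nat \<Rightarrow> nat" where
  "epoch_pos n t = t - (epoch n t - 1) * n"

text \<open>
  An outcome \<open>\<pi>\<close> of the sampling consists of the permutations \<open>\<pi> 1, \<dots>, \<pi> K\<close> of \<open>{1..n}\<close>; the
  library's product distribution fixes \<open>\<pi> k\<close> to be \<open>id\<close> for all other \<open>k\<close>.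
\<close>

definition rr_pmf :: "nat \<Rightarrow> nat \<Rightarrow> (nat \<Rightarrow> nat \<Rightarrow> nat) pmf" where
  "rr_pmf n K = Pi_pmf {1..K} id (\<lambda>_. pmf_of_set {p. p permutes {1..n}})"

definition rr_index :: "nat \<Rightarrow> (nat \<Rightarrow> nat \<Rightarrow> nat) \<Rightarrow> nat \<Rightarrow> nat" where
  "rr_index n \<pi> t = \<pi> (epoch n t) (epoch_pos n t)"

text \<open>
  A family \<open>X\<close> of trajectories, indexed by the outcomes \<open>\<pi>\<close> of the RR sampling; the minimizers
  are unique, so every \<open>X \<pi> t\<close> is determined by the permutations used before step \<open>t\<close>.
\<close>

definition rr_iterates ::
  "nat \<Rightarrow> nat \<Rightarrow> (seqvec \<Rightarrow> ereal) \<Rightarrow> (nat \<Rightarrow> seqvec \<Rightarrow> seqvec) \<Rightarrow> nat \<Rightarrow> (nat \<Rightarrow> real) \<Rightarrow>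
     seqvec \<Rightarrow> ((nat \<Rightarrow> nat \<Rightarrow> nat) \<Rightarrow> nat \<Rightarrow> seqvec) \<Rightarrow> bool" where
  "rr_iterates d n \<psi> grad T \<eta> x1 X \<longleftrightarrow>
     (\<forall>\<pi>\<in>set_pmf (rr_pmf n (epoch n T)).
        prox_grad_iterates d \<psi> grad T \<eta> (rr_index n \<pi>) x1 (X \<pi>))"

definition suffix_avg :: "nat \<Rightarrow> nat \<Rightarrow> (nat \<Rightarrow> seqvec) \<Rightarrow> seqvec" where
  "suffix_avg n T x = (1 / real n) *\<^sub>R (\<Sum>t=T - n + 1..T. x (t + 1))"

text \<open>
  Expectation of an extended real valued random variable on a finite probability space. The
  library's Bochner integral covers real values only, but \<open>F(z)\<close> may be \<open>\<infinity>\<close>.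
\<close>

definition expectation_ereal :: "'a pmf \<Rightarrow> ('a \<Rightarrow> ereal) \<Rightarrow> ereal" where
  "expectation_ereal p Y = (\<Sum>\<omega>\<in>set_pmf p. ereal (pmf p \<omega>) * Y \<omega>)"

lemma expectation_ereal_real:
  assumes "finite (set_pmf p)"
  shows "expectation_ereal p (\<lambda>\<omega>. ereal (Y \<omega>)) = ereal (measure_pmf.expectation p Y)"
  using assms
  by (subst integral_measure_pmf [of "set_pmf p"]) (auto simp: expectation_ereal_def)

lemma finite_set_rr_pmf: "finite (set_pmf (rr_pmf n K))"
proof -
  have fin: "finite {p. p permutes {1..n}}"
    by (rule finite_permutations) simp
  have ne: "{p. p permutes {1..n}} \<noteq> {}"
    using permutes_id by blast
  have "finite (PiE_dflt {1..K} id (\<lambda>_. {p. p permutes {1..n}}))"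
    using fin by (intro finite_PiE_dflt) auto
  moreover have "set_pmf (rr_pmf n K) \<subseteq> PiE_dflt {1..K} id (\<lambda>_. {p. p permutes {1..n}})"
    unfolding rr_pmf_def using fin ne
    by (intro order.trans [OF set_Pi_pmf_subset']) (simp_all add: comp_def set_pmf_of_set)
  ultimately show ?thesis by (rule rev_finite_subset)
qed

end

theory Submission
  imports Defs
begin

text \<open>
  Write \<open>B = sqrt n * G1 * G2\<close>. The suffix average is bounded through each of its terms: for
  every \<open>s \<le> T\<close>, the expected gap \<open>E F(x (s+1)) - F z\<close> is at most
  \<open>\<parallel>z - x1\<parallel>\<^sup>2 / (2 * H 1) + 28 * B * (\<Sum>t\<le>s. (\<eta> t)\<^sup>2 / H t)\<close> with \<open>H t = \<eta> t + \<dots> + \<eta> s\<close>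
  (\<open>last_iterate_bound\<close>). Both statements then follow by convexity of \<open>F\<close>, by averaging over
  \<open>s = T-n+1, \<dots>, T\<close>: with a constant stepsize all these \<open>s\<close> are at least \<open>T/2\<close>, which is what
  \<open>T \<ge> 2 * (n - 1)\<close> says, and for \<open>\<eta> / sqrt t\<close> the mean of \<open>1 / sqrt s\<close> is at most
  \<open>2 / sqrt T\<close>.

  One proximal step satisfies the usual descent inequality against any comparator \<open>y\<close>, except
  that the sampled \<open>f_i\<close> stands in the place of \<open>f\<close> at the current iterate and at \<open>y\<close>
  (\<open>prox_step_descent\<close>). If the error \<open>E (f y - f_i y)\<close> is of order \<open>\<eta> * B\<close>, also when \<open>y\<close> is an
  earlier iterate, then the sum over the steps is a regret bound against \<open>z\<close> and against every
  earlier iterate. These regret bounds can be combined with nonnegative weights into a bound on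
  the last iterate alone, since consecutive weighted suffix averages differ by a multiple of the
  regret against one iterate (\<open>weighted_suffix_last_term_bound\<close>). This costs the logarithmic
  factor.

  The error is controlled by exchangeability. In an epoch with permutation \<open>p\<close>, let \<open>y\<close> be an
  iterate computed from \<open>p 1, \<dots>, p (j-1)\<close>, and let \<open>r \<ge> j\<close> be the current position. As \<open>f\<close> is
  the mean of the \<open>f_(p k)\<close>, and exchanging the entries \<open>k\<close> and \<open>r\<close> preserves the distribution of
  \<open>p\<close>, the expectation of \<open>f y\<close> is the mean over \<open>k\<close> of the expectations of \<open>f_(p r) y'\<close>, where
  \<open>y'\<close> is computed after the exchange (\<open>rr_sampling_bias\<close>). So the error is the mean over \<open>k\<close> of
  the expectations of \<open>f_(p r) y' - f_(p r) y\<close>, which vanish for \<open>k \<ge> j\<close> and are at most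
  \<open>G_(p r) * \<parallel>y' - y\<parallel>\<close> otherwise. Before position \<open>r\<close> the two runs share all indices but the one at
  \<open>k\<close>, and monotonicity of the subdifferential makes the squared distance grow by at most
  \<open>4 * \<eta>\<^sup>2 * G_i\<^sup>2\<close> in every step with a shared index (\<open>swap_stability\<close>). With a constant stepsize
  \<open>\<parallel>y' - y\<parallel>\<close> is therefore of order \<open>\<eta> * sqrt n * G2\<close>, and together with the factor \<open>G_(p r)\<close>, of
  mean \<open>G1\<close>, this gives \<open>\<eta> * B\<close> (\<open>sampling_bias_le\<close>). With \<open>\<eta> / sqrt t\<close> the early steps of the
  first epoch are much longer than the current one, and only the mean over \<open>k\<close> has this order.
\<close>

section \<open>Weighted suffix averages\<close>

text \<open>
  The weighted mean \<open>M t\<close> of \<open>b t, \<dots>, b s\<close> with weights \<open>\<eta>\<close> satisfies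
  \<open>M (t+1) - M t = (\<eta> t / H t) * (M (t+1) - b t)\<close>, and \<open>later\<close> bounds \<open>M (t+1) - b t\<close>. Summation
  from \<open>M 1\<close>, which \<open>start\<close> compares with \<open>c\<close>, to \<open>M s = b s\<close> gives the result. As the relation
  between consecutive means is an identity that does not involve \<open>c\<close>, the values of \<open>b\<close> may lie below
  \<open>c\<close>, as can happen when \<open>c = F z\<close> is not the minimum.
\<close>

lemma weighted_suffix_last_term_bound:
  fixes \<eta> b :: "nat \<Rightarrow> real" and B D c :: real
  defines "H \<equiv> \<lambda>s t. \<Sum>\<tau>=t..s. \<eta> \<tau>"
  assumes s: "1 \<le> s" and B: "0 \<le> B"
    and pos: "\<And>t. 1 \<le> t \<Longrightarrow> 0 < \<eta> t"
    and anti: "\<And>t u. 1 \<le> t \<Longrightarrow> t \<le> u \<Longrightarrow> \<eta> u \<le> \<eta> t"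
    and start: "(\<Sum>\<tau>=1..s. \<eta> \<tau> * (b \<tau> - c)) \<le> D + B * (\<Sum>\<tau>=1..s. (\<eta> \<tau>)\<^sup>2)"
    and later: "\<And>t. 1 \<le> t \<Longrightarrow> t < s \<Longrightarrow>
      (\<Sum>\<tau>=Suc t..s. \<eta> \<tau> * (b \<tau> - b t)) \<le> B * (\<Sum>\<tau>=Suc t..s. (\<eta> \<tau>)\<^sup>2)"
  shows "b s - c \<le> D / H s 1 + 2 * B * (\<Sum>t=1..s. (\<eta> t)\<^sup>2 / H s t)"
proof -
  define M where "M = (\<lambda>t. (\<Sum>\<tau>=t..s. \<eta> \<tau> * b \<tau>) / H s t)"
  have H_pos: "0 < H s t" if "1 \<le> t" "t \<le> s" for t
    unfolding H_def using that pos by (intro sum_pos) auto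
  have H_split: "H s t = \<eta> t + H s (Suc t)" if "t \<le> s" for t
    unfolding H_def using that by (rule sum.atLeast_Suc_atMost)
  have M_eq: "(\<Sum>\<tau>=t..s. \<eta> \<tau> * b \<tau>) = M t * H s t" if "1 \<le> t" "t \<le> s" for t
    using H_pos[OF that] by (simp add: M_def)
  have step: "M (Suc t) - M t \<le> B * ((\<eta> t)\<^sup>2 / H s t)" if t: "1 \<le> t" "t < s" for t
  proof -
    have P: "0 < H s t" "0 < H s (Suc t)" "0 < \<eta> t"
      using t by (auto intro: H_pos pos)
    have "(\<Sum>\<tau>=t..s. \<eta> \<tau> * b \<tau>) = \<eta> t * b t + (\<Sum>\<tau>=Suc t..s. \<eta> \<tau> * b \<tau>)"
      using t by (intro sum.atLeast_Suc_atMost) auto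
    then have "M t * H s t = \<eta> t * b t + M (Suc t) * H s (Suc t)"
      using t by (simp add: M_eq)
    then have *: "(M (Suc t) - M t) * H s t = \<eta> t * (M (Suc t) - b t)"
      using H_split[of t] t by (simp add: algebra_simps)
    have "(\<Sum>\<tau>=Suc t..s. \<eta> \<tau> * (b \<tau> - b t)) = (M (Suc t) - b t) * H s (Suc t)"
      using t M_eq[of "Suc t"]
      by (simp add: right_diff_distrib sum_subtractf left_diff_distrib H_def
          sum_distrib_right[symmetric] mult.commute)
    then have "(M (Suc t) - b t) * H s (Suc t) \<le> B * (\<Sum>\<tau>=Suc t..s. (\<eta> \<tau>)\<^sup>2)"
      using later[OF t] by simp
    also have "(\<Sum>\<tau>=Suc t..s. (\<eta> \<tau>)\<^sup>2) \<le> (\<Sum>\<tau>=Suc t..s. \<eta> t * \<eta> \<tau>)"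
      unfolding power2_eq_square
      using t anti pos by (intro sum_mono mult_right_mono) (auto simp: less_imp_le)
    also have "\<dots> = \<eta> t * H s (Suc t)"
      by (simp add: H_def sum_distrib_left)
    finally have "(M (Suc t) - b t) * H s (Suc t) \<le> (B * \<eta> t) * H s (Suc t)"
      using B by (simp add: mult_left_mono mult.assoc)
    then have "M (Suc t) - b t \<le> B * \<eta> t"
      using P(2) by simp
    then have "(M (Suc t) - M t) * H s t \<le> \<eta> t * (B * \<eta> t)"
      unfolding * using P by (intro mult_left_mono) auto
    then show ?thesis
      using P by (simp add: field_simps power2_eq_square)
  qed
  have tele: "M t - M 1 \<le> B * (\<Sum>u=1..<t. (\<eta> u)\<^sup>2 / H s u)" if "1 \<le> t" "t \<le> s" for t
    using that
  proof (induction t rule: nat_induct_at_least)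
    case (Suc t)
    then have "M t - M 1 \<le> B * (\<Sum>u=1..<t. (\<eta> u)\<^sup>2 / H s u)"
      by simp
    with step[of t] Suc show ?case
      by (simp add: algebra_simps)
  qed simp
  have "M s = b s"
    using pos[OF s] by (simp add: M_def H_def)
  have quot: "(\<Sum>\<tau>=1..s. (\<eta> \<tau>)\<^sup>2) / H s 1 \<le> (\<Sum>t=1..s. (\<eta> t)\<^sup>2 / H s t)"
    unfolding sum_divide_distrib
  proof (intro sum_mono divide_left_mono)
    fix t assume t: "t \<in> {1..s}"
    show "H s t \<le> H s 1"
      unfolding H_def using t pos by (intro sum_mono2) (auto simp: less_imp_le)
    show "0 < H s 1 * H s t"
      using t H_pos[of 1] H_pos[of t] s by auto
  qed auto
  have "(\<Sum>\<tau>=1..s. \<eta> \<tau> * (b \<tau> - c)) = (\<Sum>\<tau>=1..s. \<eta> \<tau> * b \<tau>) - H s 1 * c"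
    by (simp add: right_diff_distrib sum_subtractf H_def sum_distrib_right)
  also have "\<dots> = (M 1 - c) * H s 1"
    using M_eq[of 1] s by (simp add: algebra_simps)
  finally have "(\<Sum>\<tau>=1..s. \<eta> \<tau> * (b \<tau> - c)) = (M 1 - c) * H s 1" .
  then have "M 1 - c \<le> (D + B * (\<Sum>\<tau>=1..s. (\<eta> \<tau>)\<^sup>2)) / H s 1"
    using start H_pos[of 1] s by (simp add: pos_le_divide_eq)
  also have "\<dots> \<le> D / H s 1 + B * (\<Sum>t=1..s. (\<eta> t)\<^sup>2 / H s t)"
    using mult_left_mono[OF quot B] by (simp add: add_divide_distrib)
  finally have "M 1 - c \<le> D / H s 1 + B * (\<Sum>t=1..s. (\<eta> t)\<^sup>2 / H s t)" .
  moreover have "B * (\<Sum>u=1..<s. (\<eta> u)\<^sup>2 / H s u) \<le> B * (\<Sum>t=1..s. (\<eta> t)\<^sup>2 / H s t)"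
    using B H_pos by (intro mult_left_mono sum_mono2) (auto intro!: divide_nonneg_pos)
  ultimately show ?thesis
    using tele[of s] s \<open>M s = b s\<close> by simp
qed

lemma sum_inverse_le_ln:
  assumes "1 \<le> T"
  shows "(\<Sum>t=1..T. 1 / real t) \<le> 1 + ln (real T)"
  using assms
proof (induction T rule: nat_induct_at_least)
  case (Suc T)
  have "ln (real T / real (Suc T)) \<le> real T / real (Suc T) - 1"
    using Suc by (intro ln_le_minus_one) simp
  then have "1 / real (Suc T) \<le> ln (real (Suc T)) - ln (real T)"
    using Suc by (simp add: ln_div field_simps)
  with Suc show ?case by simp
qed simp

lemma inverse_sqrt_le_diff:
  assumes "1 \<le> t"
  shows "1 / sqrt (real t) \<le> 2 * (sqrt (real t) - sqrt (real (t - 1)))"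
proof -
  define u v where "u = sqrt (real t)" and "v = sqrt (real (t - 1))"
  have uv: "0 < u" "0 \<le> v" "v \<le> u" "u * u - v * v = 1"
    using assms by (auto simp: u_def v_def of_nat_diff)
  then have "1 = (u - v) * (u + v)"
    by (simp add: algebra_simps)
  also have "\<dots> \<le> (u - v) * (2 * u)"
    using uv by (intro mult_left_mono) auto
  finally show ?thesis
    unfolding u_def[symmetric] v_def[symmetric] using uv(1) by (simp add: field_simps)
qed

lemma sum_inverse_sqrt_le:
  "(\<Sum>k\<in>{m<..m + n}. 1 / sqrt (real k)) \<le> 2 * (sqrt (real (m + n)) - sqrt (real m))"
proof (induction n)
  case (Suc n)
  have "{m<..m + Suc n} = insert (m + Suc n) {m<..m + n}" by auto
  then show ?case
    using Suc inverse_sqrt_le_diff[of "m + Suc n"] by simp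
qed simp

text \<open>
  Partial fractions: the summand is \<open>(1 / t + 1 / (T - t + 1)) / (T + 1)\<close>.
\<close>

lemma sum_inverse_product_le:
  assumes "1 \<le> T"
  shows "(\<Sum>t=1..T. 1 / (real t * (real T - real t + 1))) \<le> 2 * (1 + ln (real T)) / (real T + 1)"
proof -
  have "(\<Sum>t=1..T. 1 / (real t * (real T - real t + 1)))
      = (\<Sum>t=1..T. (1 / real t + 1 / real (T + 1 - t)) / (real T + 1))"
  proof (intro sum.cong refl)
    fix t assume "t \<in> {1..T}"
    then have "real T = real t + real (T - t)" "real (T + 1 - t) = real (T - t) + 1" "0 < real t"
      by auto
    then show "1 / (real t * (real T - real t + 1)) = (1 / real t + 1 / real (T + 1 - t)) / (real T + 1)"
      by (simp add: divide_simps)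
  qed
  also have "\<dots> = ((\<Sum>t=1..T. 1 / real t) + (\<Sum>t=1..T. 1 / real (T + 1 - t))) / (real T + 1)"
    by (simp add: sum_divide_distrib[symmetric] sum.distrib)
  also have "(\<Sum>t=1..T. 1 / real (T + 1 - t)) = (\<Sum>t=1..T. 1 / real t)"
    by (subst sum.atLeastAtMost_rev) (intro sum.cong; simp)
  finally show ?thesis
    using sum_inverse_le_ln[OF assms] by (simp add: divide_right_mono)
qed

section \<open>The proximal step\<close>

lemma nonpos_if_le_small_multiples:
  fixes a c :: real
  assumes "\<And>u. 0 < u \<Longrightarrow> u < 1 \<Longrightarrow> a \<le> u * c"
  shows "a \<le> 0"
proof -
  have "((\<lambda>u. u * c) \<longlongrightarrow> 0 * c) (at_right 0)"
    by (intro tendsto_intros)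
  moreover have "eventually (\<lambda>u. a \<le> u * c) (at_right (0::real))"
    using assms by (auto simp: eventually_at_right_field intro!: exI[of _ 1])
  ultimately show ?thesis
    by (intro tendsto_le[OF _ _ tendsto_const, where F = "at_right 0"]) auto
qed

context composite_problem
begin

definition psi_real :: "seqvec \<Rightarrow> real" where
  "psi_real x = real_of_ereal (\<psi> x)"

definition f_avg :: "seqvec \<Rightarrow> real" where
  "f_avg x = (\<Sum>i=1..n. f i x) / real n"

definition F_real :: "seqvec \<Rightarrow> real" where
  "F_real x = f_avg x + psi_real x"

lemma dom_Rd: "x \<in> eff_dom d \<psi> \<Longrightarrow> x \<in> Rd d"
  by (simp add: eff_dom_def)

lemma psi_eq_real:
  assumes "x \<in> eff_dom d \<psi>"
  shows "\<psi> x = ereal (psi_real x)"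
proof -
  have "\<psi> x \<noteq> -\<infinity>" "\<psi> x < \<infinity>"
    using psi_proper assms by (auto simp: proper_fun_def eff_dom_def)
  then show ?thesis
    by (cases "\<psi> x") (auto simp: psi_real_def)
qed

lemma objective_eq_real: "x \<in> eff_dom d \<psi> \<Longrightarrow> objective n f \<psi> x = ereal (F_real x)"
  by (simp add: objective_def psi_eq_real F_real_def f_avg_def)

lemma psi_segment:
  assumes "x \<in> eff_dom d \<psi>" "y \<in> eff_dom d \<psi>" "0 < u" "u < 1"
  shows "(1 - u) *\<^sub>R x + u *\<^sub>R y \<in> eff_dom d \<psi>"
    and "psi_real ((1 - u) *\<^sub>R x + u *\<^sub>R y) \<le> (1 - u) * psi_real x + u * psi_real y"
proof -
  let ?w = "(1 - u) *\<^sub>R x + u *\<^sub>R y"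
  have "\<psi> ?w \<le> ereal (1 - u) * \<psi> x + ereal u * \<psi> y"
    using psi_convex[unfolded convex_fun_def, rule_format, OF dom_Rd dom_Rd] assms by blast
  then have le: "\<psi> ?w \<le> ereal ((1 - u) * psi_real x + u * psi_real y)"
    by (simp add: psi_eq_real[OF assms(1)] psi_eq_real[OF assms(2)])
  moreover have "?w \<in> Rd d"
    using assms dom_Rd subspace_Rd by (intro subspace_add subspace_scale) auto
  ultimately show w: "?w \<in> eff_dom d \<psi>"
    by (auto simp: eff_dom_def le_less_trans)
  show "psi_real ?w \<le> (1 - u) * psi_real x + u * psi_real y"
    using le by (simp add: psi_eq_real[OF w])
qed

lemma convex_dom: "convex (eff_dom d \<psi>)"
proof (rule convexI)
  fix x y and u v :: real
  assume xy: "x \<in> eff_dom d \<psi>" "y \<in> eff_dom d \<psi>" and uv: "0 \<le> u" "0 \<le> v" "u + v = 1"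
  consider "v = 0" "u = 1" | "v = 1" "u = 0" | "0 < v" "v < 1" "u = 1 - v"
    using uv by linarith
  then show "u *\<^sub>R x + v *\<^sub>R y \<in> eff_dom d \<psi>"
    using xy psi_segment(1)[OF xy, of v] by cases simp_all
qed

lemma convex_on_F_real: "convex_on (eff_dom d \<psi>) F_real"
proof -
  have "convex_on (eff_dom d \<psi>) (\<lambda>x. \<Sum>i\<in>I. f i x)" if "I \<subseteq> {1..n}" "finite I" for I
    using that(2,1)
    by (induction I rule: finite_induct)
      (auto intro!: convex_on_add convex_on_subset[OF f_convex] convex_dom dom_Rd
        simp: convex_on_const)
  then have "convex_on (eff_dom d \<psi>) f_avg"
    unfolding f_avg_def by (intro convex_on_cdiv) auto
  moreover have "convex_on (eff_dom d \<psi>) psi_real"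
    by (intro convex_onI convex_dom psi_segment(2))
  ultimately show ?thesis
    unfolding F_real_def by (intro convex_on_add)
qed

lemma f_avg_lipschitz:
  assumes "x \<in> eff_dom d \<psi>" "y \<in> eff_dom d \<psi>"
  shows "f_avg x - f_avg y \<le> G1 n G * norm (x - y)"
proof -
  have "(\<Sum>i=1..n. f i x) - (\<Sum>i=1..n. f i y) \<le> (\<Sum>i=1..n. G i * norm (x - y))"
    unfolding sum_subtractf[symmetric]
  proof (rule sum_mono)
    fix i assume "i \<in> {1..n}"
    from lipschitz_onD[OF f_lipschitz[OF this] assms]
    show "f i x - f i y \<le> G i * norm (x - y)"
      by (simp add: dist_norm)
  qed
  then show ?thesis
    unfolding f_avg_def G1_def using n_pos
    by (simp add: diff_divide_distrib[symmetric] sum_distrib_right[symmetric] divide_right_mono)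
qed

text \<open>
  The update from \<open>x\<close> to \<open>x'\<close> with the vector \<open>g\<close> in the place of the subgradient, so that steps with
  different subgradients can be compared.
\<close>

definition is_prox_step :: "real \<Rightarrow> seqvec \<Rightarrow> seqvec \<Rightarrow> seqvec \<Rightarrow> bool" where
  "is_prox_step \<eta> g x x' \<longleftrightarrow> is_arg_min
     (\<lambda>y. \<psi> y + ereal (inner g y + (norm (y - x))\<^sup>2 / (2 * \<eta>))) (\<lambda>y. y \<in> Rd d) x'"

lemma prox_step_dom:
  assumes "is_prox_step \<eta> g x x'"
  shows "x' \<in> eff_dom d \<psi>"
proof -
  obtain y where y: "y \<in> eff_dom d \<psi>"
    using psi_proper by (auto simp: proper_fun_def)
  have "x' \<in> Rd d" and "\<not> \<psi> y + ereal (inner g y + (norm (y - x))\<^sup>2 / (2 * \<eta>))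
      < \<psi> x' + ereal (inner g x' + (norm (x' - x))\<^sup>2 / (2 * \<eta>))"
    using assms dom_Rd[OF y] by (auto simp: is_prox_step_def is_arg_min_def)
  then show ?thesis
    by (auto simp: eff_dom_def psi_eq_real[OF y] less_top[symmetric] top_ereal_def)
qed

text \<open>
  First-order optimality of \<open>x'\<close>, obtained without differentiability of \<open>\<psi>\<close>: compare \<open>x'\<close> with
  \<open>x' + u * (y - x')\<close>, divide by \<open>u\<close> and let \<open>u\<close> tend to 0. The factor \<open>\<eta>\<close> is multiplied out.
\<close>

lemma prox_step_variational:
  assumes "is_prox_step \<eta> g x x'" and y: "y \<in> eff_dom d \<psi>" and "0 < \<eta>"
  shows "\<eta> * (psi_real x' - psi_real y) \<le> inner (\<eta> *\<^sub>R g + (x' - x)) (y - x')"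
proof -
  note x' = prox_step_dom[OF assms(1)]
  let ?a = "\<eta> * (psi_real x' - psi_real y) - inner (\<eta> *\<^sub>R g + (x' - x)) (y - x')"
  have "?a \<le> u * ((norm (y - x'))\<^sup>2 / 2)" if u: "0 < u" "u < 1" for u
  proof -
    let ?w = "(1 - u) *\<^sub>R x' + u *\<^sub>R y"
    note w = psi_segment[OF x' y u]
    have "\<not> \<psi> ?w + ereal (inner g ?w + (norm (?w - x))\<^sup>2 / (2 * \<eta>))
        < \<psi> x' + ereal (inner g x' + (norm (x' - x))\<^sup>2 / (2 * \<eta>))"
      using assms(1) dom_Rd[OF w(1)] by (auto simp: is_prox_step_def is_arg_min_def)
    then have "psi_real x' + (inner g x' + (norm (x' - x))\<^sup>2 / (2 * \<eta>))
        \<le> psi_real ?w + (inner g ?w + (norm (?w - x))\<^sup>2 / (2 * \<eta>))"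
      by (simp add: psi_eq_real[OF x'] psi_eq_real[OF w(1)])
    also have "\<dots> \<le> (1 - u) * psi_real x' + u * psi_real y
        + (inner g ?w + (norm (?w - x))\<^sup>2 / (2 * \<eta>))"
      using w(2) by simp
    also have "inner g ?w = inner g x' + u * inner g (y - x')"
      by (simp add: inner_simps algebra_simps)
    also have "?w - x = (x' - x) + u *\<^sub>R (y - x')"
      by (simp add: algebra_simps)
    also have "(norm \<dots>)\<^sup>2 = (norm (x' - x))\<^sup>2 + 2 * u * inner (x' - x) (y - x')
        + u\<^sup>2 * (norm (y - x'))\<^sup>2"
      unfolding power2_norm_eq_inner inner_add_left inner_add_right
      by (simp add: power2_eq_square inner_commute)
    finally have "u * (\<eta> * (psi_real x' - psi_real y) - inner (\<eta> *\<^sub>R g + (x' - x)) (y - x'))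
        \<le> u * (u * ((norm (y - x'))\<^sup>2 / 2))"
      using \<open>0 < \<eta>\<close> by (simp add: inner_add_left divide_simps) (simp add: algebra_simps power2_eq_square)
    then show ?thesis
      using u by simp
  qed
  then have "?a \<le> 0"
    by (rule nonpos_if_le_small_multiples)
  then show ?thesis by simp
qed

text \<open>
  Add the two variational inequalities, each tested at the other minimizer; the values of \<open>\<psi>\<close>
  cancel. For \<open>x = y\<close> and \<open>g = h\<close> this is the uniqueness of the minimizer.
\<close>

lemma prox_step_nonexpansive:
  assumes "is_prox_step \<eta> g x x'" "is_prox_step \<eta> h y y'" "0 < \<eta>"
  shows "norm (x' - y') \<le> norm ((x - y) - \<eta> *\<^sub>R (g - h))"
proof -
  have "inner (x' - y') (x' - y') \<le> inner ((x - y) - \<eta> *\<^sub>R (g - h)) (x' - y')"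
    using prox_step_variational[OF assms(1) prox_step_dom[OF assms(2)] assms(3)]
      prox_step_variational[OF assms(2) prox_step_dom[OF assms(1)] assms(3)]
    by (simp add: inner_simps algebra_simps)
  also have "\<dots> \<le> norm ((x - y) - \<eta> *\<^sub>R (g - h)) * norm (x' - y')"
    by (rule norm_cauchy_schwarz)
  finally have "norm (x' - y') * norm (x' - y') \<le> norm ((x - y) - \<eta> *\<^sub>R (g - h)) * norm (x' - y')"
    by (simp add: power2_norm_eq_inner[symmetric] power2_eq_square)
  then show ?thesis
    by (cases "x' = y'") auto
qed

lemma prox_step_stable_other_index:
  assumes "is_prox_step \<eta> (grad i x) x x'" "is_prox_step \<eta> (grad j y) y y'" "0 < \<eta>"
    and "i \<in> {1..n}" "j \<in> {1..n}" "x \<in> eff_dom d \<psi>" "y \<in> eff_dom d \<psi>"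
  shows "norm (x' - y') \<le> norm (x - y) + \<eta> * (G i + G j)"
proof -
  have "norm (x' - y') \<le> norm ((x - y) - \<eta> *\<^sub>R (grad i x - grad j y))"
    by (rule prox_step_nonexpansive) fact+
  also have "\<dots> \<le> norm (x - y) + \<eta> * norm (grad i x - grad j y)"
    using norm_triangle_ineq4 \<open>0 < \<eta>\<close> by (metis abs_of_pos norm_scaleR)
  also have "norm (grad i x - grad j y) \<le> G i + G j"
    using norm_triangle_ineq4 grad_bound assms(4-7) by (meson add_mono order_trans)
  finally show ?thesis
    using \<open>0 < \<eta>\<close> by simp
qed

text \<open>
  For a nonsmooth function the subgradient step itself expands distances. By monotonicity of the
  subdifferential the cross term has the right sign, so the expansion is additive in the square.
  Hence \<open>m\<close> such steps separate two runs by order \<open>sqrt m\<close> only.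
\<close>

lemma prox_step_stable_same_index:
  assumes "is_prox_step \<eta> (grad i x) x x'" "is_prox_step \<eta> (grad i y) y y'" "0 < \<eta>"
    and i: "i \<in> {1..n}" and xy: "x \<in> eff_dom d \<psi>" "y \<in> eff_dom d \<psi>"
  shows "(norm (x' - y'))\<^sup>2 \<le> (norm (x - y))\<^sup>2 + 4 * \<eta>\<^sup>2 * (G i)\<^sup>2"
proof -
  have "f i x + inner (grad i x) (y - x) \<le> f i y" "f i y + inner (grad i y) (x - y) \<le> f i x"
    using grad_subdiff[OF i dom_Rd[OF xy(1)]] grad_subdiff[OF i dom_Rd[OF xy(2)]] xy dom_Rd
    by (auto simp: subdiff_def)
  then have mono: "0 \<le> inner (x - y) (grad i x - grad i y)"
    by (simp add: inner_simps inner_commute)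
  have "norm (grad i x - grad i y) \<le> G i + G i"
    using norm_triangle_ineq4 grad_bound i xy by (meson add_mono order_trans)
  then have bound: "(norm (grad i x - grad i y))\<^sup>2 \<le> (2 * G i)\<^sup>2"
    by (intro power_mono) auto
  have "(norm (x' - y'))\<^sup>2 \<le> (norm ((x - y) - \<eta> *\<^sub>R (grad i x - grad i y)))\<^sup>2"
    by (intro power_mono prox_step_nonexpansive assms) auto
  also have "\<dots> = (norm (x - y))\<^sup>2 - 2 * \<eta> * inner (x - y) (grad i x - grad i y)
      + \<eta>\<^sup>2 * (norm (grad i x - grad i y))\<^sup>2"
    unfolding power2_norm_eq_inner inner_diff_left[of "x - y"] inner_diff_right[of _ "x - y"]
    by (simp add: power2_eq_square inner_commute algebra_simps)
  also have "\<dots> \<le> (norm (x - y))\<^sup>2 + \<eta>\<^sup>2 * (2 * G i)\<^sup>2"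
    using mult_left_mono[OF bound, of "\<eta>\<^sup>2"] mult_nonneg_nonneg[OF less_imp_le[OF \<open>0 < \<eta>\<close>] mono]
    by simp
  finally show ?thesis
    by (simp add: power_mult_distrib algebra_simps)
qed

text \<open>
  The three-point identity turns the variational inequality into a telescoping difference of
  squared distances. Moving \<open>f\<close> from \<open>x\<close> to \<open>x'\<close> costs a multiple of \<open>\<parallel>x' - x\<parallel>\<close>, which the term
  \<open>- \<parallel>x' - x\<parallel>\<^sup>2 / 2\<close> absorbs; no bound on the length of a step is available, as \<open>\<psi>\<close> may move the
  iterate far. What remains is the error of the sampled \<open>f i\<close> at \<open>x\<close> and at \<open>y\<close>.
\<close>

lemma prox_step_descent:
  assumes step: "is_prox_step \<eta> (grad i x) x x'" "0 < \<eta>" and i: "i \<in> {1..n}"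
    and x: "x \<in> eff_dom d \<psi>" and y: "y \<in> eff_dom d \<psi>"
  shows "\<eta> * (F_real x' - F_real y) \<le> ((norm (y - x))\<^sup>2 - (norm (y - x'))\<^sup>2) / 2
    + \<eta>\<^sup>2 * ((G i)\<^sup>2 + (G1 n G)\<^sup>2) + \<eta> * ((f_avg x - f i x) - (f_avg y - f i y))"
proof -
  note x' = prox_step_dom[OF step(1)]
  define r where "r = norm (x' - x)"
  have three_point: "inner (x' - x) (y - x') = ((norm (y - x))\<^sup>2 - (norm (y - x'))\<^sup>2 - r\<^sup>2) / 2"
    unfolding r_def power2_norm_eq_inner by (simp add: inner_simps algebra_simps inner_commute)
  have "f i x + inner (grad i x) (y - x) \<le> f i y"
    using grad_subdiff[OF i dom_Rd[OF x]] dom_Rd[OF y] by (auto simp: subdiff_def)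
  moreover have "inner (grad i x) (x - x') \<le> G i * r"
  proof -
    have "inner (grad i x) (x - x') \<le> norm (grad i x) * norm (x - x')"
      by (rule norm_cauchy_schwarz)
    also have "\<dots> \<le> G i * r"
      unfolding r_def norm_minus_commute[of x'] using grad_bound[OF i x] by (intro mult_right_mono) auto
    finally show ?thesis .
  qed
  ultimately have "inner (grad i x) (y - x') \<le> f i y - f i x + G i * r"
    by (simp add: inner_simps)
  then have "\<eta> * inner (grad i x) (y - x') \<le> \<eta> * (f i y - f i x + G i * r)"
    using step(2) by simp
  moreover have "\<eta> * (psi_real x' - psi_real y) \<le> \<eta> * inner (grad i x) (y - x') + inner (x' - x) (y - x')"
    using prox_step_variational[OF step(1) y step(2)] by (simp add: inner_add_left)
  moreover have "\<eta> * f_avg x' \<le> \<eta> * (f_avg x + G1 n G * r)"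
    using f_avg_lipschitz[OF x' x] step(2) by (simp add: r_def)
  ultimately have "\<eta> * (F_real x' - F_real y) \<le> ((norm (y - x))\<^sup>2 - (norm (y - x'))\<^sup>2) / 2
      + \<eta> * ((f_avg x - f i x) - (f_avg y - f i y)) + (\<eta> * (G i + G1 n G) * r - r\<^sup>2 / 2)"
    unfolding three_point F_real_def by (simp add: algebra_simps diff_divide_distrib add_divide_distrib)
  moreover have "\<eta> * (G i + G1 n G) * r - r\<^sup>2 / 2 \<le> \<eta>\<^sup>2 * ((G i)\<^sup>2 + (G1 n G)\<^sup>2)"
    using zero_le_power2[of "r - \<eta> * (G i + G1 n G)"] zero_le_power2[of "\<eta> * (G i - G1 n G)"]
    by (simp add: power2_eq_square algebra_simps)
  ultimately show ?thesis by linarith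
qed

end

section \<open>Independent uniformly random permutations\<close>

text \<open>
  Composition on the right exchanges the entries at the positions \<open>k\<close> and \<open>r\<close> of the \<open>q\<close>-th permutation.
\<close>

definition swap_in_epoch :: "nat \<Rightarrow> nat \<Rightarrow> nat \<Rightarrow> (nat \<Rightarrow> nat \<Rightarrow> nat) \<Rightarrow> nat \<Rightarrow> nat \<Rightarrow> nat" where
  "swap_in_epoch q k r \<pi> = \<pi>(q := \<pi> q \<circ> Transposition.transpose k r)"

abbreviation rr_expectation :: "nat \<Rightarrow> nat \<Rightarrow> ((nat \<Rightarrow> nat \<Rightarrow> nat) \<Rightarrow> real) \<Rightarrow> real" where
  "rr_expectation n K \<equiv> measure_pmf.expectation (rr_pmf n K)"

lemma integrable_rr [simp, intro]: "integrable (measure_pmf (rr_pmf n K)) (Y :: _ \<Rightarrow> real)"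
  by (intro integrable_measure_pmf_finite finite_set_rr_pmf)

lemma rr_expectation_mono:
  assumes "\<And>\<pi>. \<pi> \<in> set_pmf (rr_pmf n K) \<Longrightarrow> Y \<pi> \<le> Z \<pi>"
  shows "rr_expectation n K Y \<le> rr_expectation n K Z"
  using assms by (intro integral_mono_AE integrable_rr) (simp add: AE_measure_pmf_iff)

lemma rr_expectation_cong:
  assumes "\<And>\<pi>. \<pi> \<in> set_pmf (rr_pmf n K) \<Longrightarrow> Y \<pi> = Z \<pi>"
  shows "rr_expectation n K Y = rr_expectation n K Z"
  using assms by (intro antisym rr_expectation_mono) auto

lemma rr_pmf_uniform:
  "rr_pmf n K = pmf_of_set (PiE_dflt {1..K} id (\<lambda>_. {p. p permutes {1..n}}))"
  unfolding rr_pmf_def by (rule Pi_pmf_of_set) (auto simp: finite_permutations intro: permutes_id)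

lemma finite_rr_outcomes:
  fixes n K :: nat
  shows "finite (PiE_dflt {1..K} id (\<lambda>_. {p. p permutes {1..n}}))"
  by (intro finite_PiE_dflt) (auto simp: finite_permutations)

lemma rr_outcomes_nonempty: "PiE_dflt {1..K} id (\<lambda>_. {p. p permutes {1..n}}) \<noteq> {}"
proof -
  have "(\<lambda>_. id) \<in> PiE_dflt {1..K} id (\<lambda>_. {p. p permutes {1..n}})"
    by (simp add: PiE_dflt_def permutes_id)
  then show ?thesis by blast
qed

lemma set_rr_pmf: "set_pmf (rr_pmf n K) = PiE_dflt {1..K} id (\<lambda>_. {p. p permutes {1..n}})"
  unfolding rr_pmf_uniform using rr_outcomes_nonempty finite_rr_outcomes by (rule set_pmf_of_set)

lemma rr_permutes:
  "\<pi> \<in> set_pmf (rr_pmf n K) \<Longrightarrow> q \<in> {1..K} \<Longrightarrow> \<pi> q permutes {1..n}"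
  by (auto simp: set_rr_pmf PiE_dflt_def)

lemma swap_in_epoch_involution: "swap_in_epoch q k r (swap_in_epoch q k r \<pi>) = \<pi>"
  by (simp add: swap_in_epoch_def comp_assoc)

lemma swap_in_epoch_outcome:
  assumes "\<pi> \<in> set_pmf (rr_pmf n K)" "q \<in> {1..K}" "k \<in> {1..n}" "r \<in> {1..n}"
  shows "swap_in_epoch q k r \<pi> \<in> set_pmf (rr_pmf n K)"
  using assms unfolding set_rr_pmf PiE_dflt_def swap_in_epoch_def
  by (auto intro!: permutes_compose permutes_swap_id)

lemma map_swap_in_epoch:
  assumes "q \<in> {1..K}" "k \<in> {1..n}" "r \<in> {1..n}"
  shows "map_pmf (swap_in_epoch q k r) (rr_pmf n K) = rr_pmf n K"
proof -
  have "bij_betw (swap_in_epoch q k r) (set_pmf (rr_pmf n K)) (set_pmf (rr_pmf n K))"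
    by (rule bij_betwI[where g = "swap_in_epoch q k r"])
      (auto simp: swap_in_epoch_involution swap_in_epoch_outcome[OF _ assms])
  then show ?thesis
    unfolding set_rr_pmf unfolding rr_pmf_uniform
    by (intro map_pmf_of_set_bij_betw rr_outcomes_nonempty finite_rr_outcomes)
qed

text \<open>
  The sum of \<open>\<phi> i\<close> over \<open>i\<close> is the sum of \<open>\<phi> (\<pi> q k)\<close> over the positions \<open>k\<close>. Exchanging the
  positions \<open>k\<close> and \<open>r\<close> preserves the distribution and carries the \<open>k\<close>-th summand to the one with
  \<open>\<phi> (\<pi> q r)\<close>, evaluated at \<open>Y\<close> of the exchanged outcome. The error of sampling \<open>\<phi>\<close> without
  replacement is thereby reduced to the sensitivity of \<open>Y\<close> to an exchange.
\<close>

lemma rr_sampling_bias: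
  fixes \<phi> :: "nat \<Rightarrow> 'c \<Rightarrow> real"
  assumes q: "q \<in> {1..K}" and r: "r \<in> {1..n}"
  shows "rr_expectation n K (\<lambda>\<pi>. (\<Sum>i=1..n. \<phi> i (Y \<pi>)) / real n - \<phi> (\<pi> q r) (Y \<pi>))
    = (\<Sum>k=1..n. rr_expectation n K
        (\<lambda>\<pi>. \<phi> (\<pi> q r) (Y (swap_in_epoch q k r \<pi>)) - \<phi> (\<pi> q r) (Y \<pi>))) / real n"
proof -
  let ?E = "rr_expectation n K"
  have swapped: "?E (\<lambda>\<pi>. \<phi> (\<pi> q k) (Y \<pi>)) = ?E (\<lambda>\<pi>. \<phi> (\<pi> q r) (Y (swap_in_epoch q k r \<pi>)))"
    if k: "k \<in> {1..n}" for k
  proof -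
    have "?E (\<lambda>\<pi>. \<phi> (\<pi> q k) (Y \<pi>))
        = measure_pmf.expectation (map_pmf (swap_in_epoch q k r) (rr_pmf n K)) (\<lambda>\<pi>. \<phi> (\<pi> q k) (Y \<pi>))"
      by (simp only: map_swap_in_epoch[OF q k r])
    also have "\<dots> = ?E (\<lambda>\<pi>. \<phi> (swap_in_epoch q k r \<pi> q k) (Y (swap_in_epoch q k r \<pi>)))"
      by (rule integral_map_pmf)
    finally show ?thesis
      by (simp add: swap_in_epoch_def)
  qed
  have "?E (\<lambda>\<pi>. \<Sum>i=1..n. \<phi> i (Y \<pi>)) = ?E (\<lambda>\<pi>. \<Sum>k=1..n. \<phi> (\<pi> q k) (Y \<pi>))"
  proof (rule rr_expectation_cong)
    fix \<pi> assume "\<pi> \<in> set_pmf (rr_pmf n K)"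
    then have "\<pi> q permutes {1..n}"
      using q by (rule rr_permutes)
    then show "(\<Sum>i=1..n. \<phi> i (Y \<pi>)) = (\<Sum>k=1..n. \<phi> (\<pi> q k) (Y \<pi>))"
      by (subst sum.permute) (auto simp: o_def)
  qed
  also have "\<dots> = (\<Sum>k=1..n. ?E (\<lambda>\<pi>. \<phi> (\<pi> q r) (Y (swap_in_epoch q k r \<pi>))))"
    by (simp add: swapped)
  finally have "?E (\<lambda>\<pi>. \<Sum>i=1..n. \<phi> i (Y \<pi>))
      = (\<Sum>k=1..n. ?E (\<lambda>\<pi>. \<phi> (\<pi> q r) (Y (swap_in_epoch q k r \<pi>))))" .
  then show ?thesis
    using r by (simp add: sum_subtractf diff_divide_distrib)
qed

lemma rr_expectation_entry:
  fixes \<phi> :: "nat \<Rightarrow> real"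
  assumes "q \<in> {1..K}" "r \<in> {1..n}"
  shows "rr_expectation n K (\<lambda>\<pi>. \<phi> (\<pi> q r)) = (\<Sum>i=1..n. \<phi> i) / real n"
  using rr_sampling_bias[OF assms, of "\<lambda>i _. \<phi> i" "\<lambda>_. ()"] by simp

text \<open>
  Positions in an epoch run from 1 to \<open>n\<close>; the last one is the case in which \<open>t / n\<close> is an integer.
\<close>

lemma epoch_decomposition:
  assumes "1 \<le> q" "l \<in> {1..n}"
  shows "epoch n ((q - 1) * n + l) = q" "epoch_pos n ((q - 1) * n + l) = l"
proof -
  have n: "0 < real n"
    using assms by auto
  have "real ((q - 1) * n + l) / real n = real (q - 1) + real l / real n"
    using n by (simp add: add_divide_distrib)
  moreover have "0 < real l / real n" "real l / real n \<le> 1"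
    using assms by auto
  ultimately have "\<lceil>real ((q - 1) * n + l) / real n\<rceil> = int q"
    using assms(1) by (intro ceiling_unique) (auto simp: of_nat_diff)
  then show "epoch n ((q - 1) * n + l) = q"
    by (simp add: epoch_def)
  then show "epoch_pos n ((q - 1) * n + l) = l"
    by (simp add: epoch_pos_def)
qed

lemma epoch_split:
  assumes "1 \<le> n" "1 \<le> t"
  shows "1 \<le> epoch n t" "epoch_pos n t \<in> {1..n}" "t = (epoch n t - 1) * n + epoch_pos n t"
proof -
  \<comment> \<open>Division with remainder of \<open>t - 1\<close>, because the epochs and the positions are counted from 1.\<close>
  define q l where "q = (t - 1) div n + 1" and "l = (t - 1) mod n + 1"
  have l: "l \<in> {1..n}"
    using assms by (auto simp: l_def Suc_le_eq)
  have t: "t = (q - 1) * n + l"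
    using assms by (simp add: q_def l_def)
  have "epoch n t = q" "epoch_pos n t = l"
    using epoch_decomposition[of q l n] l unfolding t[symmetric] by (auto simp: q_def)
  note eq = this
  show "1 \<le> epoch n t"
    unfolding eq by (simp add: q_def)
  show "epoch_pos n t \<in> {1..n}"
    unfolding eq by (rule l)
  show "t = (epoch n t - 1) * n + epoch_pos n t"
    unfolding eq by (rule t)
qed

lemma epoch_mono: "s \<le> t \<Longrightarrow> epoch n s \<le> epoch n t"
  unfolding epoch_def by (intro nat_mono ceiling_mono divide_right_mono) auto

section \<open>Swapping two entries and the sampling bias\<close>

context composite_problem
begin

abbreviation G_rate :: real where
  "G_rate \<equiv> sqrt (real n) * G1 n G * G2 n G"

lemma G1_nonneg: "0 \<le> G1 n G"
  unfolding G1_def using G_pos by (intro divide_nonneg_nonneg sum_nonneg) (auto simp: less_imp_le)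

lemma G2_nonneg: "0 \<le> G2 n G"
  unfolding G2_def by (intro real_sqrt_ge_zero divide_nonneg_nonneg sum_nonneg) auto

lemma G2_squared: "(G2 n G)\<^sup>2 = (\<Sum>i=1..n. (G i)\<^sup>2) / real n"
  unfolding G2_def by (intro real_sqrt_pow2 divide_nonneg_nonneg sum_nonneg) auto

lemma sum_G: "(\<Sum>i=1..n. G i) = real n * G1 n G"
  using n_pos by (simp add: G1_def)

lemma sum_G_squared: "(\<Sum>i=1..n. (G i)\<^sup>2) = real n * (G2 n G)\<^sup>2"
  using n_pos by (simp add: G2_squared)

lemma G1_le_G2: "G1 n G \<le> G2 n G"
proof (rule power2_le_imp_le[OF _ G2_nonneg])
  have "(real n * G1 n G)\<^sup>2 \<le> real n * (G2 n G)\<^sup>2 * real n"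
    using sum_squared_le_sum_of_squares[of G "{1..n}"] unfolding sum_G sum_G_squared by simp
  then show "(G1 n G)\<^sup>2 \<le> (G2 n G)\<^sup>2"
    using n_pos by (simp add: power2_eq_square mult_ac)
qed

lemma G2_le_sqrt_n_G1: "G2 n G \<le> sqrt (real n) * G1 n G"
proof (rule power2_le_imp_le)
  have "(\<Sum>i=1..n. (G i)\<^sup>2) \<le> (\<Sum>i=1..n. G i * (\<Sum>j=1..n. G j))"
    unfolding power2_eq_square
    using G_pos by (intro sum_mono mult_left_mono member_le_sum) (auto simp: less_imp_le)
  also have "\<dots> = (real n * G1 n G)\<^sup>2"
    by (simp only: sum_distrib_right[symmetric] sum_G power2_eq_square)
  finally show "(G2 n G)\<^sup>2 \<le> (sqrt (real n) * G1 n G)\<^sup>2"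
    using n_pos unfolding sum_G_squared power_mult_distrib by (simp add: power2_eq_square mult_ac)
  show "0 \<le> sqrt (real n) * G1 n G"
    using G1_nonneg by simp
qed

lemma G2_squared_le_rate: "(G2 n G)\<^sup>2 \<le> G_rate"
  using mult_right_mono[OF G2_le_sqrt_n_G1 G2_nonneg] by (simp add: power2_eq_square)

lemma G1_squared_le_rate: "(G1 n G)\<^sup>2 \<le> G_rate"
  using power_mono[OF G1_le_G2 G1_nonneg, of 2] G2_squared_le_rate by linarith

lemma G_rate_nonneg: "0 \<le> G_rate"
  using G1_nonneg G2_nonneg by simp

end

text \<open>
  The induction step of \<open>swap_stability\<close>: an offset \<open>a\<close> outside of the square root survives an
  additive growth of the square, since the mixed term \<open>a * sqrt s\<close> only increases.
\<close>

lemma add_sqrt_sum_square_le: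
  fixes a s c :: real
  assumes "0 \<le> a" "0 \<le> s" "0 \<le> c"
  shows "(a + 2 * sqrt s)\<^sup>2 + 4 * c \<le> (a + 2 * sqrt (s + c))\<^sup>2"
proof -
  have "a * sqrt s \<le> a * sqrt (s + c)"
    using assms by (intro mult_left_mono) auto
  moreover have "(sqrt s)\<^sup>2 = s" "(sqrt (s + c))\<^sup>2 = s + c"
    using assms by auto
  ultimately show ?thesis
    by (simp add: power2_sum power_mult_distrib)
qed

text \<open>
  The condition \<open>step_epoch\<close> relates the stepsizes of one epoch, which starts after time \<open>b\<close>, to the
  current one. It allows \<open>\<eta> (b + l)\<close> to exceed \<open>\<eta> (b + r)\<close> by a factor \<open>sqrt (n / l)\<close>, as is
  necessary for \<open>\<eta> / sqrt t\<close> in the first epoch, and it still suffices for a bias of order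
  \<open>\<eta> t\<close>.
\<close>

locale rr_run = composite_problem +
  fixes T :: nat and \<eta> :: "nat \<Rightarrow> real" and x1 :: seqvec
    and X :: "(nat \<Rightarrow> nat \<Rightarrow> nat) \<Rightarrow> nat \<Rightarrow> seqvec"
  assumes x1_dom: "x1 \<in> eff_dom d \<psi>"
    and iterates: "rr_iterates d n \<psi> grad T \<eta> x1 X"
    and step_pos: "\<And>t. 1 \<le> t \<Longrightarrow> 0 < \<eta> t"
    and step_antimono: "\<And>t u. 1 \<le> t \<Longrightarrow> t \<le> u \<Longrightarrow> \<eta> u \<le> \<eta> t"
    and step_epoch: "\<And>b l r. 1 \<le> l \<Longrightarrow> l \<le> r \<Longrightarrow> r \<le> n \<Longrightarrow>
      real l * (\<eta> (b + l))\<^sup>2 \<le> real n * (\<eta> (b + r))\<^sup>2"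
begin

abbreviation outcomes :: "(nat \<Rightarrow> nat \<Rightarrow> nat) set" where
  "outcomes \<equiv> set_pmf (rr_pmf n (epoch n T))"

abbreviation E :: "((nat \<Rightarrow> nat \<Rightarrow> nat) \<Rightarrow> real) \<Rightarrow> real" where
  "E \<equiv> rr_expectation n (epoch n T)"

lemma X_start: "\<pi> \<in> outcomes \<Longrightarrow> X \<pi> 1 = x1"
  using iterates by (auto simp: rr_iterates_def prox_grad_iterates_def)

lemma X_step:
  assumes "\<pi> \<in> outcomes" "t \<in> {1..T}"
  shows "is_prox_step (\<eta> t) (grad (rr_index n \<pi> t) (X \<pi> t)) (X \<pi> t) (X \<pi> (Suc t))"
  using iterates assms by (auto simp: rr_iterates_def prox_grad_iterates_def is_prox_step_def)

lemma X_dom: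
  assumes "\<pi> \<in> outcomes" "1 \<le> t" "t \<le> Suc T"
  shows "X \<pi> t \<in> eff_dom d \<psi>"
proof (cases "t = 1")
  case True
  then show ?thesis
    using X_start[OF assms(1)] x1_dom by simp
next
  case False
  then have "t - 1 \<in> {1..T}" "Suc (t - 1) = t"
    using assms by auto
  then show ?thesis
    using prox_step_dom[OF X_step[OF assms(1), of "t - 1"]] by simp
qed

lemma epoch_in_range:
  assumes "t \<in> {1..T}"
  shows "epoch n t \<in> {1..epoch n T}"
  using assms epoch_split(1)[OF n_pos] epoch_mono[of t T n] by auto

lemma rr_index_in_range:
  assumes "\<pi> \<in> outcomes" "t \<in> {1..T}"
  shows "rr_index n \<pi> t \<in> {1..n}"
  unfolding rr_index_def permutes_in_image[OF rr_permutes[OF assms(1) epoch_in_range[OF assms(2)]]]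
  using epoch_split(2)[OF n_pos, of t] assms(2) by auto

lemma X_eq_if_indices_eq:
  assumes "\<pi> \<in> outcomes" "\<pi>' \<in> outcomes" "1 \<le> s" "s \<le> Suc T"
    and "\<And>u. 1 \<le> u \<Longrightarrow> u < s \<Longrightarrow> rr_index n \<pi> u = rr_index n \<pi>' u"
  shows "X \<pi> s = X \<pi>' s"
  using assms(3-5)
proof (induction s rule: nat_induct_at_least)
  case base
  then show ?case
    using X_start assms(1,2) by simp
next
  case (Suc u)
  have "X \<pi> u = X \<pi>' u" "rr_index n \<pi> u = rr_index n \<pi>' u" "u \<in> {1..T}"
    using Suc by auto
  then have "norm (X \<pi> (Suc u) - X \<pi>' (Suc u)) \<le> 0"
    using prox_step_nonexpansive[OF X_step[OF assms(1)] X_step[OF assms(2)], of u] step_pos[of u]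
    by simp
  then show ?case by simp
qed

lemma rr_index_swap:
  assumes "1 \<le> u" "k \<in> {1..n}" "r \<in> {1..n}"
    and "\<And>l. l \<in> {1..n} \<Longrightarrow> u = (q - 1) * n + l \<Longrightarrow> l \<noteq> k \<and> l \<noteq> r"
  shows "rr_index n (swap_in_epoch q k r \<pi>) u = rr_index n \<pi> u"
proof (cases "epoch n u = q")
  case True
  then have "epoch_pos n u \<noteq> k \<and> epoch_pos n u \<noteq> r"
    using epoch_split[OF n_pos assms(1)] by (intro assms(4)) auto
  then show ?thesis
    by (simp add: rr_index_def swap_in_epoch_def transpose_apply_other)
qed (simp add: rr_index_def swap_in_epoch_def)

text \<open>
  The iterate at time \<open>s\<close> depends on the indices before \<open>s\<close> only, and both exchanged positions lie
  at time \<open>s\<close> or later.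
\<close>

lemma X_swap_unaffected:
  assumes "\<pi> \<in> outcomes" "q \<in> {1..epoch n T}" "k \<in> {1..n}" "r \<in> {1..n}"
    and "1 \<le> s" "s \<le> Suc T" "s \<le> (q - 1) * n + k" "s \<le> (q - 1) * n + r"
  shows "X (swap_in_epoch q k r \<pi>) s = X \<pi> s"
  using assms
  by (intro X_eq_if_indices_eq swap_in_epoch_outcome rr_index_swap) auto

lemma rr_index_epoch:
  assumes "1 \<le> q" "l \<in> {1..n}"
  shows "rr_index n \<pi> ((q - 1) * n + l) = \<pi> q l"
  unfolding rr_index_def epoch_decomposition[OF assms] by (rule refl)

text \<open>
  The runs agree up to position \<open>k\<close>, where the exchange puts the index \<open>\<pi> q r\<close> in the place of
  \<open>\<pi> q k\<close>; this step separates them by at most the first summand. As \<open>u \<le> r\<close>, every later step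
  before position \<open>u\<close> uses a common index, so that the squared distance grows additively.
\<close>

lemma swap_stability:
  fixes q k r :: nat
  defines "b \<equiv> (q - 1) * n"
  assumes \<pi>: "\<pi> \<in> outcomes" and q: "q \<in> {1..epoch n T}"
    and k: "1 \<le> k" "k < u" and u: "u \<le> r" and r: "r \<le> n" "b + r \<le> T"
  shows "norm (X (swap_in_epoch q k r \<pi>) (b + u) - X \<pi> (b + u))
    \<le> \<eta> (b + k) * (G (\<pi> q k) + G (\<pi> q r))
      + 2 * sqrt (\<Sum>l\<in>{k<..<u}. (\<eta> (b + l))\<^sup>2 * (G (\<pi> q l))\<^sup>2)"
  using k(2) u
proof (induction u rule: less_induct)
  case (less u)
  let ?\<sigma> = "swap_in_epoch q k r \<pi>"
  let ?a = "\<eta> (b + k) * (G (\<pi> q k) + G (\<pi> q r))"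
  define v where "v = u - 1"
  have v: "u = Suc v" "k \<le> v" "v < r" "1 \<le> v"
    using less k by (auto simp: v_def)
  have kr: "k \<in> {1..n}" "r \<in> {1..n}"
    using v k r by auto
  have v_time: "b + v \<in> {1..T}" and v_pos: "v \<in> {1..n}"
    using v r by auto
  have \<sigma>: "?\<sigma> \<in> outcomes"
    using swap_in_epoch_outcome[OF \<pi> q kr] .
  have dom: "X ?\<sigma> (b + v) \<in> eff_dom d \<psi>" "X \<pi> (b + v) \<in> eff_dom d \<psi>"
    using X_dom[OF \<sigma>] X_dom[OF \<pi>] v_time by auto
  have G_nonneg: "0 \<le> G (\<pi> q l)" if "l \<in> {1..n}" for l
    using rr_permutes[OF \<pi> q] G_pos that by (metis less_imp_le permutes_in_image)
  have a: "0 \<le> ?a"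
    using G_nonneg[OF kr(1)] G_nonneg[OF kr(2)] step_pos[of "b + k"] k(1) by simp
  have idx: "rr_index n \<pi> (b + v) = \<pi> q v" "rr_index n ?\<sigma> (b + v) = ?\<sigma> q v"
    unfolding b_def using rr_index_epoch[of q v] q v_pos by auto
  have step_v: "0 < \<eta> (b + v)"
    using step_pos v_time by simp
  note steps = X_step[OF \<sigma> v_time] X_step[OF \<pi> v_time]
  show ?case
  proof (cases "v = k")
    case True
    have "X ?\<sigma> (b + v) = X \<pi> (b + v)"
      unfolding b_def using \<pi> q kr v v_time True less.prems(2)
      by (intro X_swap_unaffected) (auto simp: b_def)
    moreover have "?\<sigma> q v = \<pi> q r"
      using True by (simp add: swap_in_epoch_def)
    ultimately have "norm (X ?\<sigma> (Suc (b + v)) - X \<pi> (Suc (b + v))) \<le> \<eta> (b + v) * (G (\<pi> q r) + G (\<pi> q v))"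
      using prox_step_stable_other_index[OF steps step_v rr_index_in_range[OF \<sigma> v_time]
          rr_index_in_range[OF \<pi> v_time] dom] by (simp add: idx)
    moreover have "{k<..<u} = {}"
      using v True by auto
    ultimately show ?thesis
      using v True by (simp add: add.commute)
  next
    case False
    let ?S = "\<lambda>u. \<Sum>l\<in>{k<..<u}. (\<eta> (b + l))\<^sup>2 * (G (\<pi> q l))\<^sup>2"
    have S_nonneg: "0 \<le> ?S v"
      by (intro sum_nonneg) auto
    have IH: "norm (X ?\<sigma> (b + v) - X \<pi> (b + v)) \<le> ?a + 2 * sqrt (?S v)"
      using less.IH[of v] v False by simp
    have same: "rr_index n ?\<sigma> (b + v) = rr_index n \<pi> (b + v)"
      using v False unfolding idx by (simp add: swap_in_epoch_def transpose_apply_other)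
    have "(norm (X ?\<sigma> (Suc (b + v)) - X \<pi> (Suc (b + v))))\<^sup>2
        \<le> (norm (X ?\<sigma> (b + v) - X \<pi> (b + v)))\<^sup>2 + 4 * (\<eta> (b + v))\<^sup>2 * (G (\<pi> q v))\<^sup>2"
      using prox_step_stable_same_index[OF steps(1)[unfolded same] steps(2) step_v
          rr_index_in_range[OF \<pi> v_time] dom] by (simp add: idx)
    also have "\<dots> \<le> (?a + 2 * sqrt (?S v))\<^sup>2 + 4 * ((\<eta> (b + v))\<^sup>2 * (G (\<pi> q v))\<^sup>2)"
      using power_mono[OF IH, of 2] by simp
    also have "\<dots> \<le> (?a + 2 * sqrt (?S v + (\<eta> (b + v))\<^sup>2 * (G (\<pi> q v))\<^sup>2))\<^sup>2"
      using a S_nonneg by (intro add_sqrt_sum_square_le) auto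
    also have "?S v + (\<eta> (b + v))\<^sup>2 * (G (\<pi> q v))\<^sup>2 = ?S u"
    proof -
      have "{k<..<u} = insert v {k<..<v}"
        using v False by auto
      then show ?thesis by simp
    qed
    finally have "norm (X ?\<sigma> (Suc (b + v)) - X \<pi> (Suc (b + v))) \<le> ?a + 2 * sqrt (?S u)"
      by (rule power2_le_imp_le) (use a in \<open>auto intro!: add_nonneg_nonneg sum_nonneg\<close>)
    then show ?thesis
      using v by simp
  qed
qed

text \<open>
  By \<open>step_epoch\<close>, \<open>\<eta> (b + k)\<close> is at most \<open>sqrt (n / k) * \<eta> (b + r)\<close>, and the sum of \<open>1 / sqrt k\<close> up to
  \<open>n\<close> is at most \<open>2 * sqrt n\<close>.
\<close>

lemma sum_steps_before_le:
  assumes "j \<le> r" "1 \<le> r" "r \<le> n"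
  shows "(\<Sum>k\<in>{1..<j}. \<eta> (b + k)) \<le> 2 * real n * \<eta> (b + r)"
proof -
  have \<eta>r: "0 \<le> \<eta> (b + r)"
    using step_pos[of "b + r"] assms by simp
  have "(\<Sum>k\<in>{1..<j}. \<eta> (b + k)) \<le> (\<Sum>k\<in>{1..<j}. sqrt (real n) * \<eta> (b + r) * (1 / sqrt (real k)))"
  proof (rule sum_mono)
    fix k assume k: "k \<in> {1..<j}"
    have "real k * (\<eta> (b + k))\<^sup>2 \<le> real n * (\<eta> (b + r))\<^sup>2"
      using k assms by (intro step_epoch) auto
    then have "(sqrt (real k) * \<eta> (b + k))\<^sup>2 \<le> (sqrt (real n) * \<eta> (b + r))\<^sup>2"
      by (simp add: power_mult_distrib)
    then have "sqrt (real k) * \<eta> (b + k) \<le> sqrt (real n) * \<eta> (b + r)"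
      by (rule power2_le_imp_le) (intro mult_nonneg_nonneg real_sqrt_ge_zero of_nat_0_le_iff \<eta>r)
    then show "\<eta> (b + k) \<le> sqrt (real n) * \<eta> (b + r) * (1 / sqrt (real k))"
      using k by (simp add: pos_le_divide_eq mult.commute)
  qed
  also have "\<dots> = sqrt (real n) * \<eta> (b + r) * (\<Sum>k\<in>{1..<j}. 1 / sqrt (real k))"
    by (simp add: sum_distrib_left)
  also have "(\<Sum>k\<in>{1..<j}. 1 / sqrt (real k)) \<le> (\<Sum>k\<in>{0<..0 + n}. 1 / sqrt (real k))"
    using assms by (intro sum_mono2) auto
  also have "\<dots> \<le> 2 * sqrt (real n)"
    using sum_inverse_sqrt_le[of 0 n] by simp
  finally have "(\<Sum>k\<in>{1..<j}. \<eta> (b + k)) \<le> sqrt (real n) * \<eta> (b + r) * (2 * sqrt (real n))"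
    using \<eta>r by (simp add: mult_left_mono)
  also have "\<dots> = 2 * (sqrt (real n) * sqrt (real n)) * \<eta> (b + r)"
    by (simp only: mult_ac)
  finally show ?thesis by simp
qed

text \<open>
  Cauchy-Schwarz in \<open>k\<close> and an exchange of the sums leave each term \<open>l\<close> with the factor \<open>l - 1\<close>. This
  factor is what \<open>step_epoch\<close> absorbs: without summation over \<open>k\<close>, the steps
  \<open>\<eta> / sqrt t\<close> of the first epoch would produce an additional logarithm.
\<close>

lemma sum_sqrt_tails_le:
  assumes p: "p permutes {1..n}" and "j \<le> r" "1 \<le> r" "r \<le> n"
  shows "(\<Sum>k\<in>{1..<j}. sqrt (\<Sum>l\<in>{k<..<j}. (\<eta> (b + l))\<^sup>2 * (G (p l))\<^sup>2))
    \<le> real n * (sqrt (real n) * \<eta> (b + r) * G2 n G)"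
proof (rule power2_le_imp_le)
  let ?c = "\<lambda>l. (\<eta> (b + l))\<^sup>2 * (G (p l))\<^sup>2"
  have "(\<Sum>k\<in>{1..<j}. \<Sum>l\<in>{k<..<j}. ?c l) = (\<Sum>k\<in>{1..<j}. \<Sum>l\<in>{l\<in>{1..<j}. k < l}. ?c l)"
    by (intro sum.cong) auto
  also have "\<dots> = (\<Sum>l\<in>{1..<j}. \<Sum>k\<in>{k\<in>{1..<j}. k < l}. ?c l)"
    by (rule sum.swap_restrict) auto
  also have "\<dots> \<le> (\<Sum>l\<in>{1..<j}. real n * (\<eta> (b + r))\<^sup>2 * (G (p l))\<^sup>2)"
  proof (rule sum_mono)
    fix l assume l: "l \<in> {1..<j}"
    have "card {k\<in>{1..<j}. k < l} \<le> card {1..<Suc l}"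
      by (intro card_mono) auto
    then have "(\<Sum>k\<in>{k\<in>{1..<j}. k < l}. ?c l) \<le> real l * ?c l"
      by (simp add: mult_right_mono)
    also have "\<dots> \<le> real n * (\<eta> (b + r))\<^sup>2 * (G (p l))\<^sup>2"
      using step_epoch[of l r b] l assms by (simp add: mult_right_mono mult.assoc[symmetric])
    finally show "(\<Sum>k\<in>{k\<in>{1..<j}. k < l}. ?c l) \<le> real n * (\<eta> (b + r))\<^sup>2 * (G (p l))\<^sup>2" .
  qed
  also have "\<dots> = real n * (\<eta> (b + r))\<^sup>2 * (\<Sum>l\<in>{1..<j}. (G (p l))\<^sup>2)"
    by (simp add: sum_distrib_left)
  also have "\<dots> \<le> real n * (\<eta> (b + r))\<^sup>2 * (\<Sum>l\<in>{1..n}. (G (p l))\<^sup>2)"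
    using assms by (intro mult_left_mono sum_mono2) auto
  also have "(\<Sum>l\<in>{1..n}. (G (p l))\<^sup>2) = real n * (G2 n G)\<^sup>2"
    using sum.permute[OF p, of "\<lambda>i. (G i)\<^sup>2"] unfolding sum_G_squared o_def by simp
  finally have tails: "(\<Sum>k\<in>{1..<j}. \<Sum>l\<in>{k<..<j}. ?c l)
      \<le> real n * (\<eta> (b + r))\<^sup>2 * (real n * (G2 n G)\<^sup>2)"
    .
  have "(\<Sum>k\<in>{1..<j}. sqrt (\<Sum>l\<in>{k<..<j}. ?c l))\<^sup>2
      \<le> (\<Sum>k\<in>{1..<j}. (sqrt (\<Sum>l\<in>{k<..<j}. ?c l))\<^sup>2) * real (card {1..<j})"
    by (rule sum_squared_le_sum_of_squares)
  also have "(\<Sum>k\<in>{1..<j}. (sqrt (\<Sum>l\<in>{k<..<j}. ?c l))\<^sup>2) = (\<Sum>k\<in>{1..<j}. \<Sum>l\<in>{k<..<j}. ?c l)"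
    by (intro sum.cong refl real_sqrt_pow2 sum_nonneg) auto
  also have "\<dots> * real (card {1..<j}) \<le> real n * (\<eta> (b + r))\<^sup>2 * (real n * (G2 n G)\<^sup>2) * real n"
    using tails assms by (intro mult_mono) auto
  also have "\<dots> = (real n * (sqrt (real n) * \<eta> (b + r) * G2 n G))\<^sup>2"
    by (simp add: power_mult_distrib) (simp add: power2_eq_square mult_ac)
  finally show "(\<Sum>k\<in>{1..<j}. sqrt (\<Sum>l\<in>{k<..<j}. ?c l))\<^sup>2 \<le> \<dots>" .
  show "0 \<le> real n * (sqrt (real n) * \<eta> (b + r) * G2 n G)"
    using step_pos[of "b + r"] assms G2_nonneg by simp
qed

text \<open>
  Insert \<open>swap_stability\<close> into \<open>rr_sampling_bias\<close>. The two summands of the stability bound contribute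
  \<open>4 * \<eta> t * G2\<^sup>2\<close> and \<open>2 * \<eta> t * B\<close>, where \<open>B = sqrt n * G1 * G2\<close> dominates \<open>G2\<^sup>2\<close>.
\<close>

lemma sampling_bias_le:
  assumes t: "t \<in> {1..T}" and s: "1 \<le> s" "s \<le> t"
  shows "\<bar>E (\<lambda>\<pi>. f_avg (X \<pi> s) - f (rr_index n \<pi> t) (X \<pi> s))\<bar> \<le> 6 * \<eta> t * G_rate"
proof -
  define q r b where "q = epoch n t" and "r = epoch_pos n t" and "b = (q - 1) * n"
  \<comment> \<open>The position of \<open>s\<close> in the epoch of \<open>t\<close>. For \<open>s\<close> in an earlier epoch the truncated difference is
    0, the range \<open>{1..<j}\<close> is empty and the bias vanishes.\<close>
  define j where "j = s - b"
  have r: "r \<in> {1..n}" and t_eq: "t = b + r" and q: "q \<in> {1..epoch n T}"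
    unfolding q_def r_def b_def using epoch_split(2,3)[OF n_pos, of t] epoch_in_range[OF t] t
    by simp_all
  have j: "j \<le> r" "r \<le> n" "1 \<le> r"
    using s r t_eq by (auto simp: j_def)
  have idx: "rr_index n \<pi> t = \<pi> q r" for \<pi>
    by (simp add: rr_index_def q_def r_def)
  let ?D = "\<lambda>k \<pi>. f (\<pi> q r) (X (swap_in_epoch q k r \<pi>) s) - f (\<pi> q r) (X \<pi> s)"
  let ?S = "\<lambda>k \<pi>. \<Sum>l\<in>{k<..<j}. (\<eta> (b + l))\<^sup>2 * (G (\<pi> q l))\<^sup>2"
  let ?B = "\<lambda>k \<pi>. G (\<pi> q r) * (\<eta> (b + k) * (G (\<pi> q k) + G (\<pi> q r)) + 2 * sqrt (?S k \<pi>))"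
  have unaffected: "E (?D k) = 0" if "k \<in> {1..n} - {1..<j}" for k
  proof -
    have "E (?D k) = E (\<lambda>_. 0)"
    proof (rule rr_expectation_cong)
      fix \<pi> assume "\<pi> \<in> outcomes"
      then have "X (swap_in_epoch q k r \<pi>) s = X \<pi> s"
        using that q r s t t_eq by (intro X_swap_unaffected) (auto simp: j_def b_def)
      then show "?D k \<pi> = 0" by simp
    qed
    then show ?thesis by simp
  qed
  have affected: "\<bar>E (?D k)\<bar> \<le> E (?B k)" if k: "k \<in> {1..<j}" for k
  proof -
    have "\<bar>E (?D k)\<bar> \<le> E (\<lambda>\<pi>. \<bar>?D k \<pi>\<bar>)"
      by (rule integral_abs_bound)
    also have "\<dots> \<le> E (?B k)"
    proof (rule rr_expectation_mono)
      fix \<pi> assume \<pi>: "\<pi> \<in> outcomes"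
      have s_eq: "s = b + j"
        using k by (auto simp: j_def)
      have k': "k \<in> {1..n}"
        using k j by auto
      have i: "\<pi> q r \<in> {1..n}"
        using rr_index_in_range[OF \<pi> t] by (simp add: idx)
      have "\<bar>?D k \<pi>\<bar> \<le> G (\<pi> q r) * norm (X (swap_in_epoch q k r \<pi>) s - X \<pi> s)"
        using lipschitz_onD[OF f_lipschitz[OF i] X_dom[OF swap_in_epoch_outcome[OF \<pi> q k' r]] X_dom[OF \<pi>], of s s]
          s t by (simp add: dist_norm)
      also have "\<dots> \<le> ?B k \<pi>"
        unfolding s_eq b_def using G_pos[OF i] \<pi> q k j t t_eq
        by (intro mult_left_mono swap_stability) (auto simp: b_def)
      finally show "\<bar>?D k \<pi>\<bar> \<le> ?B k \<pi>" .
    qed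
    finally show ?thesis .
  qed
  \<comment> \<open>In this upper bound the mixed products \<open>G (\<pi> q r) * G (\<pi> q k)\<close> are replaced by squares, so that its
    expectation needs the distribution of single entries only.\<close>
  let ?R = "\<lambda>\<pi>. (\<Sum>k\<in>{1..<j}. \<eta> (b + k) * (((G (\<pi> q k))\<^sup>2 + 3 * (G (\<pi> q r))\<^sup>2) / 2))
      + 2 * G (\<pi> q r) * (real n * (sqrt (real n) * \<eta> t * G2 n G))"
  have path: "(\<Sum>k\<in>{1..<j}. ?B k \<pi>) \<le> ?R \<pi>" if \<pi>: "\<pi> \<in> outcomes" for \<pi>
  proof -
    have "0 \<le> G (\<pi> q r)"
      using G_pos rr_index_in_range[OF \<pi> t] by (simp add: idx less_imp_le)
    have "(\<Sum>k\<in>{1..<j}. ?B k \<pi>)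
        = (\<Sum>k\<in>{1..<j}. \<eta> (b + k) * (G (\<pi> q r) * G (\<pi> q k) + (G (\<pi> q r))\<^sup>2))
          + 2 * G (\<pi> q r) * (\<Sum>k\<in>{1..<j}. sqrt (?S k \<pi>))"
      by (simp add: sum.distrib[symmetric] sum_distrib_left algebra_simps power2_eq_square)
    also have "\<dots> \<le> ?R \<pi>"
    proof (intro add_mono sum_mono mult_left_mono)
      fix k assume "k \<in> {1..<j}"
      then show "0 \<le> \<eta> (b + k)"
        using step_pos[of "b + k"] by simp
      show "G (\<pi> q r) * G (\<pi> q k) + (G (\<pi> q r))\<^sup>2 \<le> ((G (\<pi> q k))\<^sup>2 + 3 * (G (\<pi> q r))\<^sup>2) / 2"
        using sum_squares_bound[of "G (\<pi> q r)" "G (\<pi> q k)"] by simp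
    next
      show "(\<Sum>k\<in>{1..<j}. sqrt (?S k \<pi>)) \<le> real n * (sqrt (real n) * \<eta> t * G2 n G)"
        unfolding t_eq using j by (intro sum_sqrt_tails_le rr_permutes[OF \<pi> q]) auto
    qed (use \<open>0 \<le> G (\<pi> q r)\<close> in auto)
    finally show ?thesis .
  qed
  have G_entry: "E (\<lambda>\<pi>. G (\<pi> q r)) = G1 n G"
    using rr_expectation_entry[OF q r, of G] by (simp add: G1_def)
  have G_sq_entry: "E (\<lambda>\<pi>. (G (\<pi> q k))\<^sup>2) = (G2 n G)\<^sup>2" if "k \<in> {1..n}" for k
    using rr_expectation_entry[OF q that, of "\<lambda>i. (G i)\<^sup>2"] by (simp add: G2_squared)
  have "E ?R = (\<Sum>k\<in>{1..<j}. 2 * (\<eta> (b + k) * (G2 n G)\<^sup>2))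
      + 2 * G1 n G * (real n * (sqrt (real n) * \<eta> t * G2 n G))"
    using j r by (simp add: G_entry G_sq_entry)
  also have "\<dots> = (\<Sum>k\<in>{1..<j}. \<eta> (b + k)) * (2 * (G2 n G)\<^sup>2) + real n * (2 * \<eta> t * G_rate)"
    by (simp add: sum_distrib_left sum_distrib_right mult_ac)
  also have "\<dots> \<le> (2 * real n * \<eta> t) * (2 * G_rate) + real n * (2 * \<eta> t * G_rate)"
    using sum_steps_before_le[OF j(1,3,2), of b] G2_squared_le_rate step_pos[of t] t
    by (intro add_right_mono mult_mono) (auto simp: t_eq less_imp_le)
  finally have ER: "E ?R \<le> real n * (6 * \<eta> t * G_rate)"
    by (simp add: algebra_simps)
  have "E (\<lambda>\<pi>. f_avg (X \<pi> s) - f (rr_index n \<pi> t) (X \<pi> s)) = (\<Sum>k=1..n. E (?D k)) / real n"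
    unfolding f_avg_def idx by (rule rr_sampling_bias[OF q r])
  also have "(\<Sum>k=1..n. E (?D k)) = (\<Sum>k\<in>{1..<j}. E (?D k))"
    using j unaffected by (intro sum.mono_neutral_right) auto
  finally have "\<bar>E (\<lambda>\<pi>. f_avg (X \<pi> s) - f (rr_index n \<pi> t) (X \<pi> s))\<bar>
      = \<bar>\<Sum>k\<in>{1..<j}. E (?D k)\<bar> / real n"
    by simp
  also have "\<dots> \<le> (\<Sum>k\<in>{1..<j}. E (?B k)) / real n"
    by (intro divide_right_mono order.trans[OF sum_abs] sum_mono affected) auto
  also have "(\<Sum>k\<in>{1..<j}. E (?B k)) = E (\<lambda>\<pi>. \<Sum>k\<in>{1..<j}. ?B k \<pi>)"
    by (rule Bochner_Integration.integral_sum[symmetric]) simp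
  also have "\<dots> \<le> E ?R"
    by (intro rr_expectation_mono path)
  also note ER
  also have "real n * (6 * \<eta> t * G_rate) / real n = 6 * \<eta> t * G_rate"
    using n_pos by simp
  finally show ?thesis
    by (simp add: divide_right_mono)
qed

end

section \<open>The last iterate and the suffix average\<close>

context rr_run
begin

text \<open>
  The constant is \<open>14 = 2 + 6 + 6\<close>: \<open>G1\<^sup>2 + G2\<^sup>2\<close>, the bias at the current iterate, and the bias at the
  comparator.
\<close>

lemma expected_step:
  assumes t: "t \<in> {1..T}" and Y: "\<And>\<pi>. \<pi> \<in> outcomes \<Longrightarrow> Y \<pi> \<in> eff_dom d \<psi>"
    and bias: "\<bar>E (\<lambda>\<pi>. f_avg (Y \<pi>) - f (rr_index n \<pi> t) (Y \<pi>))\<bar> \<le> 6 * \<eta> t * G_rate"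
  shows "\<eta> t * (E (\<lambda>\<pi>. F_real (X \<pi> (Suc t))) - E (\<lambda>\<pi>. F_real (Y \<pi>)))
    \<le> (E (\<lambda>\<pi>. (norm (Y \<pi> - X \<pi> t))\<^sup>2) - E (\<lambda>\<pi>. (norm (Y \<pi> - X \<pi> (Suc t)))\<^sup>2)) / 2
      + 14 * G_rate * (\<eta> t)\<^sup>2"
proof -
  have \<eta>: "0 < \<eta> t"
    using t step_pos by simp
  let ?i = "\<lambda>\<pi>. rr_index n \<pi> t"
  let ?bias = "\<lambda>y \<pi>. f_avg (y \<pi>) - f (?i \<pi>) (y \<pi>)"
  have "E (\<lambda>\<pi>. \<eta> t * (F_real (X \<pi> (Suc t)) - F_real (Y \<pi>)))
      \<le> E (\<lambda>\<pi>. ((norm (Y \<pi> - X \<pi> t))\<^sup>2 - (norm (Y \<pi> - X \<pi> (Suc t)))\<^sup>2) / 2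
        + (\<eta> t)\<^sup>2 * ((G (?i \<pi>))\<^sup>2 + (G1 n G)\<^sup>2) + \<eta> t * (?bias (\<lambda>\<pi>. X \<pi> t) \<pi> - ?bias Y \<pi>))"
    using t Y \<eta> by (intro rr_expectation_mono prox_step_descent X_step X_dom rr_index_in_range) auto
  also have "\<dots> = (E (\<lambda>\<pi>. (norm (Y \<pi> - X \<pi> t))\<^sup>2) - E (\<lambda>\<pi>. (norm (Y \<pi> - X \<pi> (Suc t)))\<^sup>2)) / 2
        + (\<eta> t)\<^sup>2 * (E (\<lambda>\<pi>. (G (?i \<pi>))\<^sup>2) + (G1 n G)\<^sup>2)
        + \<eta> t * (E (?bias (\<lambda>\<pi>. X \<pi> t)) - E (?bias Y))"
    by simp
  also have "E (\<lambda>\<pi>. (G (?i \<pi>))\<^sup>2) = (G2 n G)\<^sup>2"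
    unfolding rr_index_def G2_squared
    using rr_expectation_entry[OF epoch_in_range[OF t] epoch_split(2)[OF n_pos], of t "\<lambda>i. (G i)\<^sup>2"] t
    by simp
  also have "(\<eta> t)\<^sup>2 * ((G2 n G)\<^sup>2 + (G1 n G)\<^sup>2) \<le> (\<eta> t)\<^sup>2 * (2 * G_rate)"
    using G1_squared_le_rate G2_squared_le_rate by (intro mult_left_mono) auto
  also have "\<eta> t * (E (?bias (\<lambda>\<pi>. X \<pi> t)) - E (?bias Y)) \<le> \<eta> t * (12 * \<eta> t * G_rate)"
    using sampling_bias_le[OF t, of t] bias t \<eta> by (intro mult_left_mono) (auto simp: abs_le_iff)
  finally have "E (\<lambda>\<pi>. \<eta> t * (F_real (X \<pi> (Suc t)) - F_real (Y \<pi>)))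
      \<le> (E (\<lambda>\<pi>. (norm (Y \<pi> - X \<pi> t))\<^sup>2) - E (\<lambda>\<pi>. (norm (Y \<pi> - X \<pi> (Suc t)))\<^sup>2)) / 2
        + (\<eta> t)\<^sup>2 * (2 * G_rate) + \<eta> t * (12 * \<eta> t * G_rate)"
    by simp
  also have "\<dots> = (E (\<lambda>\<pi>. (norm (Y \<pi> - X \<pi> t))\<^sup>2) - E (\<lambda>\<pi>. (norm (Y \<pi> - X \<pi> (Suc t)))\<^sup>2)) / 2
      + 14 * G_rate * (\<eta> t)\<^sup>2"
    by (simp add: power2_eq_square)
  finally show ?thesis
    by simp
qed

lemma expected_regret:
  assumes Y: "\<And>\<pi>. \<pi> \<in> outcomes \<Longrightarrow> Y \<pi> \<in> eff_dom d \<psi>" and us: "1 \<le> u" "u \<le> s" "s \<le> T"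
    and bias: "\<And>t. u \<le> t \<Longrightarrow> t \<le> s \<Longrightarrow>
      \<bar>E (\<lambda>\<pi>. f_avg (Y \<pi>) - f (rr_index n \<pi> t) (Y \<pi>))\<bar> \<le> 6 * \<eta> t * G_rate"
  shows "(\<Sum>t=u..s. \<eta> t * (E (\<lambda>\<pi>. F_real (X \<pi> (Suc t))) - E (\<lambda>\<pi>. F_real (Y \<pi>))))
    \<le> E (\<lambda>\<pi>. (norm (Y \<pi> - X \<pi> u))\<^sup>2) / 2 + 14 * G_rate * (\<Sum>t=u..s. (\<eta> t)\<^sup>2)"
proof -
  let ?N = "\<lambda>t. E (\<lambda>\<pi>. (norm (Y \<pi> - X \<pi> t))\<^sup>2) / 2"
  have "(\<Sum>t=u..s. \<eta> t * (E (\<lambda>\<pi>. F_real (X \<pi> (Suc t))) - E (\<lambda>\<pi>. F_real (Y \<pi>))))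
      \<le> (\<Sum>t=u..s. - (?N (Suc t) - ?N t) + 14 * G_rate * (\<eta> t)\<^sup>2)"
  proof (rule sum_mono)
    fix t assume "t \<in> {u..s}"
    then show "\<eta> t * (E (\<lambda>\<pi>. F_real (X \<pi> (Suc t))) - E (\<lambda>\<pi>. F_real (Y \<pi>)))
        \<le> - (?N (Suc t) - ?N t) + 14 * G_rate * (\<eta> t)\<^sup>2"
      using expected_step[OF _ Y bias, of t] us by (simp add: diff_divide_distrib)
  qed
  also have "\<dots> = - (\<Sum>t=u..s. ?N (Suc t) - ?N t) + 14 * G_rate * (\<Sum>t=u..s. (\<eta> t)\<^sup>2)"
    by (simp only: sum.distrib sum_negf sum_distrib_left)
  also have "(\<Sum>t=u..s. ?N (Suc t) - ?N t) = ?N (Suc s) - ?N u"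
    using us by (intro sum_Suc_diff) auto
  finally have "(\<Sum>t=u..s. \<eta> t * (E (\<lambda>\<pi>. F_real (X \<pi> (Suc t))) - E (\<lambda>\<pi>. F_real (Y \<pi>))))
      \<le> - (?N (Suc s) - ?N u) + 14 * G_rate * (\<Sum>t=u..s. (\<eta> t)\<^sup>2)" .
  moreover have "0 \<le> ?N (Suc s)"
    by simp
  ultimately show ?thesis by linarith
qed

text \<open>
  The comparators in \<open>weighted_suffix_last_term_bound\<close> are \<open>z\<close> and the iterates \<open>x (u+1)\<close> themselves.
  In the second case the regret is summed from the time \<open>u+1\<close> on, where the initial distance is 0. A
  constant comparator is not affected by exchanges and has no bias.
\<close>

lemma last_iterate_bound:
  assumes z: "z \<in> eff_dom d \<psi>" and s: "1 \<le> s" "s \<le> T"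
  shows "E (\<lambda>\<pi>. F_real (X \<pi> (Suc s))) - F_real z
    \<le> (norm (z - x1))\<^sup>2 / 2 / (\<Sum>\<tau>=1..s. \<eta> \<tau>)
      + 28 * G_rate * (\<Sum>t=1..s. (\<eta> t)\<^sup>2 / (\<Sum>\<tau>=t..s. \<eta> \<tau>))"
proof -
  have "E (\<lambda>\<pi>. F_real (X \<pi> (Suc s))) - F_real z
    \<le> (norm (z - x1))\<^sup>2 / 2 / (\<Sum>\<tau>=1..s. \<eta> \<tau>)
      + 2 * (14 * G_rate) * (\<Sum>t=1..s. (\<eta> t)\<^sup>2 / (\<Sum>\<tau>=t..s. \<eta> \<tau>))"
  \<comment> \<open>The index is shifted: \<open>b t\<close> belongs to the point produced by step \<open>t\<close>.\<close>
  proof (rule weighted_suffix_last_term_bound[where b = "\<lambda>t. E (\<lambda>\<pi>. F_real (X \<pi> (Suc t)))"])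
    have fixed: "\<bar>E (\<lambda>\<pi>. f_avg z - f (rr_index n \<pi> t) z)\<bar> \<le> 6 * \<eta> t * G_rate"
      if "1 \<le> t" "t \<le> s" for t
    proof -
      have "E (\<lambda>\<pi>. f_avg z - f (rr_index n \<pi> t) z) = 0"
        unfolding f_avg_def rr_index_def
        using rr_sampling_bias[OF epoch_in_range epoch_split(2)[OF n_pos], of t t f "\<lambda>_. z"] that s
        by simp
      then show ?thesis
        using G_rate_nonneg step_pos[OF that(1)] by simp
    qed
    have "E (\<lambda>\<pi>. (norm (z - X \<pi> 1))\<^sup>2) = E (\<lambda>\<pi>. (norm (z - x1))\<^sup>2)"
      by (intro rr_expectation_cong) (simp only: X_start)
    then show "(\<Sum>t=1..s. \<eta> t * (E (\<lambda>\<pi>. F_real (X \<pi> (Suc t))) - F_real z))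
        \<le> (norm (z - x1))\<^sup>2 / 2 + 14 * G_rate * (\<Sum>t=1..s. (\<eta> t)\<^sup>2)"
      using expected_regret[of "\<lambda>_. z" 1 s] z s fixed by simp
    show "(\<Sum>t=Suc u..s. \<eta> t * (E (\<lambda>\<pi>. F_real (X \<pi> (Suc t))) - E (\<lambda>\<pi>. F_real (X \<pi> (Suc u)))))
        \<le> 14 * G_rate * (\<Sum>t=Suc u..s. (\<eta> t)\<^sup>2)" if "1 \<le> u" "u < s" for u
      using expected_regret[of "\<lambda>\<pi>. X \<pi> (Suc u)" "Suc u" s] sampling_bias_le[of _ "Suc u"] X_dom that s
      by simp
  qed (use s G_rate_nonneg step_pos step_antimono in auto)
  then show ?thesis by simp
qed

lemma suffix_avg_dom_jensen:
  assumes "\<pi> \<in> outcomes" "n \<le> T"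
  shows "suffix_avg n T (X \<pi>) \<in> eff_dom d \<psi>"
    and "F_real (suffix_avg n T (X \<pi>)) \<le> (\<Sum>s=T - n + 1..T. F_real (X \<pi> (Suc s))) / real n"
proof -
  have *: "suffix_avg n T (X \<pi>) = (\<Sum>s=T - n + 1..T. (1 / real n) *\<^sub>R X \<pi> (Suc s))"
    by (simp add: suffix_avg_def scaleR_sum_right)
  have w: "(\<Sum>s=T - n + 1..T. 1 / real n) = 1"
    using n_pos assms(2) by simp
  have dom: "X \<pi> (Suc s) \<in> eff_dom d \<psi>" if "s \<in> {T - n + 1..T}" for s
    using that assms by (intro X_dom) auto
  show "suffix_avg n T (X \<pi>) \<in> eff_dom d \<psi>"
    unfolding * by (rule convex_sum[OF _ convex_dom w _ dom]) simp_all
  have "F_real (suffix_avg n T (X \<pi>)) \<le> (\<Sum>s=T - n + 1..T. 1 / real n * F_real (X \<pi> (Suc s)))"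
    unfolding * by (rule convex_on_sum[OF _ _ convex_on_F_real w _ dom]) (use n_pos assms(2) in simp_all)
  then show "F_real (suffix_avg n T (X \<pi>)) \<le> (\<Sum>s=T - n + 1..T. F_real (X \<pi> (Suc s))) / real n"
    by (simp add: sum_divide_distrib)
qed

text \<open>
  For \<open>z\<close> in the domain of \<open>\<psi>\<close> all values are finite, and Jensen's inequality applies. Otherwise the
  difference is \<open>-\<infinity>\<close> for every outcome, and hence below every real number.
\<close>

lemma suffix_average_bound:
  assumes "n \<le> T"
    and last: "\<And>s. z \<in> eff_dom d \<psi> \<Longrightarrow> T - n + 1 \<le> s \<Longrightarrow> s \<le> T \<Longrightarrow>
      E (\<lambda>\<pi>. F_real (X \<pi> (Suc s))) - F_real z \<le> R s"
    and R: "(\<Sum>s=T - n + 1..T. R s) / real n \<le> B"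
    and z: "z \<in> Rd d"
  shows "expectation_ereal (rr_pmf n (epoch n T))
      (\<lambda>\<pi>. objective n f \<psi> (suffix_avg n T (X \<pi>)) - objective n f \<psi> z) \<le> ereal B"
proof (cases "z \<in> eff_dom d \<psi>")
  case True
  let ?I = "{T - n + 1..T}"
  have card: "real (card ?I) = real n"
    using \<open>n \<le> T\<close> n_pos by simp
  have "expectation_ereal (rr_pmf n (epoch n T))
      (\<lambda>\<pi>. objective n f \<psi> (suffix_avg n T (X \<pi>)) - objective n f \<psi> z)
    = expectation_ereal (rr_pmf n (epoch n T)) (\<lambda>\<pi>. ereal (F_real (suffix_avg n T (X \<pi>)) - F_real z))"
    unfolding expectation_ereal_def
    using True \<open>n \<le> T\<close> by (intro sum.cong refl) (simp add: objective_eq_real suffix_avg_dom_jensen)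
  also have "\<dots> = ereal (E (\<lambda>\<pi>. F_real (suffix_avg n T (X \<pi>)) - F_real z))"
    by (rule expectation_ereal_real[OF finite_set_rr_pmf])
  also have "\<dots> \<le> ereal B"
  proof -
    have "E (\<lambda>\<pi>. F_real (suffix_avg n T (X \<pi>)) - F_real z)
        \<le> E (\<lambda>\<pi>. (\<Sum>s\<in>?I. F_real (X \<pi> (Suc s))) / real n - F_real z)"
      using \<open>n \<le> T\<close> by (intro rr_expectation_mono diff_right_mono suffix_avg_dom_jensen)
    also have "\<dots> = (\<Sum>s\<in>?I. E (\<lambda>\<pi>. F_real (X \<pi> (Suc s)))) / real n - real (card ?I) * F_real z / real n"
      unfolding card using n_pos by simp
    also have "\<dots> = (\<Sum>s\<in>?I. E (\<lambda>\<pi>. F_real (X \<pi> (Suc s))) - F_real z) / real n"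
      by (simp only: sum_subtractf sum_constant diff_divide_distrib)
    also have "\<dots> \<le> (\<Sum>s\<in>?I. R s) / real n"
      using last[OF True] by (intro divide_right_mono sum_mono) auto
    also note R
    finally show ?thesis by simp
  qed
  finally show ?thesis .
next
  case False
  then have "\<psi> z = \<infinity>"
    using z by (simp add: eff_dom_def)
  then have "expectation_ereal (rr_pmf n (epoch n T))
      (\<lambda>\<pi>. objective n f \<psi> (suffix_avg n T (X \<pi>)) - objective n f \<psi> z)
    \<le> expectation_ereal (rr_pmf n (epoch n T)) (\<lambda>\<pi>. ereal B)"
    unfolding expectation_ereal_def
    using \<open>n \<le> T\<close> objective_eq_real[OF suffix_avg_dom_jensen(1)]
    by (intro sum_mono ereal_mult_left_mono) (auto simp: objective_def)
  also have "\<dots> = ereal B"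
    by (simp add: expectation_ereal_real finite_set_rr_pmf)
  finally show ?thesis .
qed

end

section \<open>Constant and inverse square root stepsizes\<close>

lemma sum_constant_steps_le:
  fixes \<eta> :: real
  assumes "0 < \<eta>" "1 \<le> s"
  shows "(\<Sum>t=1..s. \<eta>\<^sup>2 / (\<Sum>\<tau>=t..s. \<eta>)) \<le> \<eta> * (1 + ln (real s))"
proof -
  have "(\<Sum>t=1..s. \<eta>\<^sup>2 / (\<Sum>\<tau>=t..s. \<eta>)) = (\<Sum>t=1..s. \<eta> * (1 / real (Suc s - t)))"
  proof (rule sum.cong[OF refl])
    fix t assume "t \<in> {1..s}"
    then have "0 < real (Suc s - t)" by simp
    moreover have "(\<Sum>\<tau>=t..s. \<eta>) = real (Suc s - t) * \<eta>" by simp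
    ultimately show "\<eta>\<^sup>2 / (\<Sum>\<tau>=t..s. \<eta>) = \<eta> * (1 / real (Suc s - t))"
      using assms(1) by (simp only: power2_eq_square) simp
  qed
  also have "\<dots> = \<eta> * (\<Sum>t=1..s. 1 / real (Suc s - t))"
    by (simp only: sum_distrib_left)
  also have "(\<Sum>t=1..s. 1 / real (Suc s - t)) = (\<Sum>t=1..s. 1 / real t)"
    by (subst sum.atLeastAtMost_rev) (intro sum.cong; simp)
  finally show ?thesis
    using sum_inverse_le_ln[OF assms(2)] assms(1) by (simp add: mult_left_mono)
qed

lemma sum_inverse_sqrt_steps_ge:
  fixes \<eta> :: real
  assumes "0 < \<eta>" "1 \<le> t" "t \<le> s"
  shows "\<eta> * (real s - real t + 1) / sqrt (real s) \<le> (\<Sum>\<tau>=t..s. \<eta> / sqrt (real \<tau>))"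
proof -
  have "(\<Sum>\<tau>=t..s. \<eta> / sqrt (real s)) \<le> (\<Sum>\<tau>=t..s. \<eta> / sqrt (real \<tau>))"
    using assms by (intro sum_mono frac_le) (simp_all add: less_imp_le)
  moreover have "real (Suc s - t) = real s - real t + 1"
    using assms by simp
  ultimately show ?thesis
    by (simp only: sum_constant card_atLeastAtMost times_divide_eq_right mult.commute[of _ \<eta>])
qed

text \<open>
  Bounding each stepsize in \<open>H t\<close> from below by the last one leaves the sum of
  \<open>1 / (t * (s - t + 1))\<close>. It is of order \<open>ln s / s\<close>, because one of the two factors is always at least
  half of \<open>s\<close>.
\<close>

lemma sum_inverse_sqrt_steps_le:
  fixes \<eta> :: real
  assumes "0 < \<eta>" "1 \<le> s"
  shows "(\<Sum>t=1..s. (\<eta> / sqrt (real t))\<^sup>2 / (\<Sum>\<tau>=t..s. \<eta> / sqrt (real \<tau>)))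
    \<le> 2 * \<eta> * (1 + ln (real s)) / sqrt (real s)"
proof -
  have "(\<Sum>t=1..s. (\<eta> / sqrt (real t))\<^sup>2 / (\<Sum>\<tau>=t..s. \<eta> / sqrt (real \<tau>)))
      \<le> (\<Sum>t=1..s. \<eta> * sqrt (real s) * (1 / (real t * (real s - real t + 1))))"
  proof (rule sum_mono)
    fix t assume t: "t \<in> {1..s}"
    let ?h = "\<eta> * (real s - real t + 1) / sqrt (real s)"
    have h: "0 < ?h"
      using t assms by (intro divide_pos_pos mult_pos_pos) simp_all
    have "?h \<le> (\<Sum>\<tau>=t..s. \<eta> / sqrt (real \<tau>))"
      using t assms by (intro sum_inverse_sqrt_steps_ge) auto
    then have "(\<eta> / sqrt (real t))\<^sup>2 / (\<Sum>\<tau>=t..s. \<eta> / sqrt (real \<tau>)) \<le> (\<eta> / sqrt (real t))\<^sup>2 / ?h"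
      using h by (intro frac_le) simp_all
    also have "\<dots> = \<eta> * sqrt (real s) * (1 / (real t * (real s - real t + 1)))"
      using t assms h by (simp add: power_divide power2_eq_square)
    finally show "(\<eta> / sqrt (real t))\<^sup>2 / (\<Sum>\<tau>=t..s. \<eta> / sqrt (real \<tau>))
        \<le> \<eta> * sqrt (real s) * (1 / (real t * (real s - real t + 1)))" .
  qed
  also have "\<dots> = \<eta> * sqrt (real s) * (\<Sum>t=1..s. 1 / (real t * (real s - real t + 1)))"
    by (simp only: sum_distrib_left)
  also have "\<dots> \<le> \<eta> * sqrt (real s) * (2 * (1 + ln (real s)) / (real s + 1))"
    using sum_inverse_product_le[OF assms(2)] assms by (intro mult_left_mono) auto
  also have "\<dots> \<le> \<eta> * sqrt (real s) * (2 * (1 + ln (real s)) / real s)"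
    using assms by (intro mult_left_mono divide_left_mono) auto
  also have "\<dots> = 2 * \<eta> * (1 + ln (real s)) * (sqrt (real s) / real s)"
    by simp
  also have "sqrt (real s) / real s = 1 / sqrt (real s)"
    using assms real_sqrt_mult_self[of "real s"] by (simp add: field_simps)
  finally show ?thesis by simp
qed

text \<open>
  With \<open>m = T - n\<close>, the sum is at most \<open>2 * (sqrt T - sqrt m)\<close>, and
  \<open>(sqrt T - sqrt m) * sqrt T \<le> T - m = n\<close>.
\<close>

lemma mean_inverse_sqrt_le:
  assumes "1 \<le> n" "n \<le> T"
  shows "(\<Sum>s=T - n + 1..T. 1 / sqrt (real s)) / real n \<le> 2 / sqrt (real T)"
proof -
  define m where "m = T - n"
  have T: "T = m + n" and pos: "0 < sqrt (real T)"
    using assms by (auto simp: m_def)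
  have "sqrt (real m) * sqrt (real m) \<le> sqrt (real m) * sqrt (real T)"
    by (rule mult_left_mono) (simp_all add: T)
  moreover have "sqrt (real m) * sqrt (real m) = real m" "sqrt (real T) * sqrt (real T) = real T"
    by simp_all
  ultimately have "(sqrt (real T) - sqrt (real m)) * sqrt (real T) \<le> real T - real m"
    by (simp only: left_diff_distrib)
  also have "\<dots> = real n"
    by (simp add: T)
  finally have gap: "sqrt (real T) - sqrt (real m) \<le> real n / sqrt (real T)"
    using pos by (simp add: pos_le_divide_eq)
  have "{T - n + 1..T} = {m<..m + n}"
    using assms by (auto simp: m_def)
  then have "(\<Sum>s=T - n + 1..T. 1 / sqrt (real s)) \<le> 2 * (sqrt (real T) - sqrt (real m))"
    using sum_inverse_sqrt_le[of m n] T by simp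
  also have "\<dots> \<le> 2 * (real n / sqrt (real T))"
    using gap by (rule mult_left_mono) simp
  also have "\<dots> = real n * (2 / sqrt (real T))"
    by simp
  finally show ?thesis
    using assms by (simp add: pos_divide_le_eq mult.commute)
qed

lemma constant_step_bound:
  assumes "composite_problem d n f \<psi> G grad" and T: "n \<le> T" "2 * (n - 1) \<le> T" and \<eta>: "0 < \<eta>"
    and "x1 \<in> eff_dom d \<psi>" and "rr_iterates d n \<psi> grad T (\<lambda>t. \<eta>) x1 X" and z: "z \<in> Rd d"
  shows "expectation_ereal (rr_pmf n (epoch n T))
      (\<lambda>\<pi>. objective n f \<psi> (suffix_avg n T (X \<pi>)) - objective n f \<psi> z)
    \<le> ereal (28 * ((norm (z - x1))\<^sup>2 / (\<eta> * real T) +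
             \<eta> * sqrt (real n) * G1 n G * G2 n G * (1 + ln (real T))))"
proof -
  interpret composite_problem d n f \<psi> G grad by fact
  interpret rr_run d n f \<psi> G grad T "\<lambda>_. \<eta>" x1 X
    using assms by unfold_locales (auto intro!: mult_right_mono)
  let ?D = "(norm (z - x1))\<^sup>2"
  let ?R = "?D / (\<eta> * real T) + 28 * G_rate * (\<eta> * (1 + ln (real T)))"
  have T_pos: "1 \<le> T"
    using T n_pos by simp
  show ?thesis
  proof (rule suffix_average_bound[OF \<open>n \<le> T\<close> _ _ z])
    fix s assume z_dom: "z \<in> eff_dom d \<psi>" and s: "T - n + 1 \<le> s" "s \<le> T"
    have s1: "1 \<le> s"
      using s by simp
    have "2 * (T - n + 1) \<ge> T"
      using T n_pos by arith
    then have "T \<le> 2 * s"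
      using s(1) by (meson le_trans mult_le_mono2)
    then have "real T \<le> 2 * real s"
      by linarith
    then have "\<eta> * real T \<le> 2 * (real s * \<eta>)"
      using \<eta> by (simp add: mult.commute mult_left_mono)
    then have "?D / (2 * (real s * \<eta>)) \<le> ?D / (\<eta> * real T)"
      using \<eta> T_pos by (intro frac_le) simp_all
    moreover have "28 * G_rate * (\<Sum>t=1..s. \<eta>\<^sup>2 / (\<Sum>\<tau>=t..s. \<eta>))
        \<le> 28 * G_rate * (\<eta> * (1 + ln (real T)))"
    proof (rule mult_left_mono)
      have "(\<Sum>t=1..s. \<eta>\<^sup>2 / (\<Sum>\<tau>=t..s. \<eta>)) \<le> \<eta> * (1 + ln (real s))"
        by (rule sum_constant_steps_le[OF \<eta> s1])
      also have "\<dots> \<le> \<eta> * (1 + ln (real T))"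
        using \<eta> s1 s by simp
      finally show "(\<Sum>t=1..s. \<eta>\<^sup>2 / (\<Sum>\<tau>=t..s. \<eta>)) \<le> \<eta> * (1 + ln (real T))" .
      show "0 \<le> 28 * G_rate"
        using G_rate_nonneg by simp
    qed
    moreover have "?D / 2 / (\<Sum>\<tau>=1..s. \<eta>) = ?D / (2 * (real s * \<eta>))"
      by simp
    ultimately show "E (\<lambda>\<pi>. F_real (X \<pi> (Suc s))) - F_real z \<le> ?R"
      using last_iterate_bound[OF z_dom s1 s(2)] by linarith
  next
    have "0 \<le> ?D / (\<eta> * real T)"
      using \<eta> by simp
    have "(\<Sum>s=T - n + 1..T. ?R) / real n = ?R"
      using T n_pos by simp
    also have "\<dots> \<le> 28 * (?D / (\<eta> * real T)) + 28 * G_rate * (\<eta> * (1 + ln (real T)))"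
      using \<open>0 \<le> ?D / (\<eta> * real T)\<close> by linarith
    also have "\<dots> = 28 * (?D / (\<eta> * real T) + \<eta> * sqrt (real n) * G1 n G * G2 n G * (1 + ln (real T)))"
      by (simp only: distrib_left mult_ac)
    finally show "(\<Sum>s=T - n + 1..T. ?R) / real n
      \<le> 28 * (?D / (\<eta> * real T) + \<eta> * sqrt (real n) * G1 n G * G2 n G * (1 + ln (real T)))" .
  qed
qed

lemma inverse_sqrt_step_bound:
  assumes "composite_problem d n f \<psi> G grad" and T: "n \<le> T" and \<eta>: "0 < \<eta>"
    and "x1 \<in> eff_dom d \<psi>" and "rr_iterates d n \<psi> grad T (\<lambda>t. \<eta> / sqrt (real t)) x1 X"
    and z: "z \<in> Rd d"
  shows "expectation_ereal (rr_pmf n (epoch n T))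
      (\<lambda>\<pi>. objective n f \<psi> (suffix_avg n T (X \<pi>)) - objective n f \<psi> z)
    \<le> ereal (112 * (((norm (z - x1))\<^sup>2 / \<eta> +
             \<eta> * sqrt (real n) * G1 n G * G2 n G * (1 + ln (real T))) * (1 / sqrt (real T))))"
proof -
  interpret composite_problem d n f \<psi> G grad by fact
  interpret rr_run d n f \<psi> G grad T "\<lambda>t. \<eta> / sqrt (real t)" x1 X
  proof (unfold_locales)
    fix b l r :: nat
    assume l: "1 \<le> l" "l \<le> r" "r \<le> n"
    \<comment> \<open>This is \<open>l / (b + l) \<le> n / (b + r)\<close> without denominators; it needs both \<open>l \<le> n\<close> and \<open>r \<le> n\<close>.\<close>
    have "l * b + l * r \<le> n * b + n * l"
      using l by (metis add_mono le_trans mult.commute mult_le_mono1)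
    then have "real (l * b + l * r) \<le> real (n * b + n * l)"
      by (rule of_nat_mono)
    then have "real l * (real b + real r) \<le> real n * (real b + real l)"
      by (simp add: algebra_simps)
    moreover have "0 < real b + real l" "0 < real b + real r"
      using l by auto
    ultimately have "real l / (real b + real l) \<le> real n / (real b + real r)"
      by (simp add: divide_simps)
    then have "\<eta>\<^sup>2 * (real l / (real b + real l)) \<le> \<eta>\<^sup>2 * (real n / (real b + real r))"
      by (rule mult_left_mono) simp
    then show "real l * (\<eta> / sqrt (real (b + l)))\<^sup>2 \<le> real n * (\<eta> / sqrt (real (b + r)))\<^sup>2"
      by (simp add: power_divide mult.commute)
  next
    fix t u :: nat
    assume "1 \<le> t" "t \<le> u"
    then show "\<eta> / sqrt (real u) \<le> \<eta> / sqrt (real t)"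
      using \<eta> by (intro frac_le) simp_all
  qed (use assms in simp_all)
  let ?D = "(norm (z - x1))\<^sup>2"
  let ?c = "?D / (2 * \<eta>) + 28 * G_rate * (2 * \<eta> * (1 + ln (real T)))"
  have T_pos: "1 \<le> T"
    using T n_pos by simp
  have c_nonneg: "0 \<le> ?c"
    using \<eta> T_pos by (intro add_nonneg_nonneg mult_nonneg_nonneg) (simp_all add: G1_nonneg G2_nonneg)
  show ?thesis
  proof (rule suffix_average_bound[OF \<open>n \<le> T\<close> _ _ z])
    fix s assume z_dom: "z \<in> eff_dom d \<psi>" and s: "T - n + 1 \<le> s" "s \<le> T"
    have s1: "1 \<le> s"
      using s by simp
    let ?\<eta> = "\<lambda>t. \<eta> / sqrt (real t)"
    have "\<eta> * sqrt (real s) \<le> (\<Sum>\<tau>=1..s. ?\<eta> \<tau>)"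
      using sum_inverse_sqrt_steps_ge[OF \<eta> order.refl s1]
      by (simp add: real_div_sqrt times_divide_eq_right[symmetric] del: times_divide_eq_right)
    then have "?D / 2 / (\<Sum>\<tau>=1..s. ?\<eta> \<tau>) \<le> ?D / 2 / (\<eta> * sqrt (real s))"
      using \<eta> s1 by (intro frac_le) simp_all
    also have "\<dots> = ?D / (2 * \<eta>) * (1 / sqrt (real s))"
      by simp
    finally have start: "?D / 2 / (\<Sum>\<tau>=1..s. ?\<eta> \<tau>) \<le> ?D / (2 * \<eta>) * (1 / sqrt (real s))" .
    have "(\<Sum>t=1..s. (?\<eta> t)\<^sup>2 / (\<Sum>\<tau>=t..s. ?\<eta> \<tau>)) \<le> 2 * \<eta> * (1 + ln (real s)) / sqrt (real s)"
      by (rule sum_inverse_sqrt_steps_le[OF \<eta> s1])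
    also have "\<dots> \<le> 2 * \<eta> * (1 + ln (real T)) / sqrt (real s)"
      using \<eta> s1 s by (intro divide_right_mono mult_left_mono) simp_all
    finally have "28 * G_rate * (\<Sum>t=1..s. (?\<eta> t)\<^sup>2 / (\<Sum>\<tau>=t..s. ?\<eta> \<tau>))
        \<le> 28 * G_rate * (2 * \<eta> * (1 + ln (real T)) / sqrt (real s))"
      using G_rate_nonneg by (intro mult_left_mono) simp_all
    then have noise: "28 * G_rate * (\<Sum>t=1..s. (?\<eta> t)\<^sup>2 / (\<Sum>\<tau>=t..s. ?\<eta> \<tau>))
        \<le> 28 * G_rate * (2 * \<eta> * (1 + ln (real T))) * (1 / sqrt (real s))"
      by simp
    show "E (\<lambda>\<pi>. F_real (X \<pi> (Suc s))) - F_real z \<le> ?c * (1 / sqrt (real s))"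
      using last_iterate_bound[OF z_dom s1 s(2)] start noise unfolding distrib_right by linarith
  next
    have "0 \<le> ?D / \<eta>"
      using \<eta> by simp
    then have "?D / \<eta> \<le> 112 * (?D / \<eta>)"
      by linarith
    have "(\<Sum>s=T - n + 1..T. ?c * (1 / sqrt (real s))) / real n
        = ?c * ((\<Sum>s=T - n + 1..T. 1 / sqrt (real s)) / real n)"
      by (subst sum_distrib_left[symmetric]) (rule times_divide_eq_right[symmetric])
    also have "\<dots> \<le> ?c * (2 / sqrt (real T))"
      using c_nonneg by (intro mult_left_mono mean_inverse_sqrt_le n_pos T)
    also have "\<dots> = (?D / \<eta> + 112 * (G_rate * (\<eta> * (1 + ln (real T))))) * (1 / sqrt (real T))"
      by (simp add: distrib_right)
    also have "\<dots> \<le> (112 * (?D / \<eta>) + 112 * (G_rate * (\<eta> * (1 + ln (real T))))) * (1 / sqrt (real T))"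
      by (intro mult_right_mono add_right_mono \<open>?D / \<eta> \<le> 112 * (?D / \<eta>)\<close>) simp
    also have "\<dots> = 112 * ((?D / \<eta> + \<eta> * sqrt (real n) * G1 n G * G2 n G * (1 + ln (real T))) * (1 / sqrt (real T)))"
      by (simp only: distrib_left mult_ac)
    finally show "(\<Sum>s=T - n + 1..T. ?c * (1 / sqrt (real s))) / real n
      \<le> 112 * ((?D / \<eta> + \<eta> * sqrt (real n) * G1 n G * G2 n G * (1 + ln (real T))) * (1 / sqrt (real T)))" .
  qed
qed

theorem corollaryA2:
  shows
    "(\<exists>C>0. \<forall>d n f \<psi> G grad T \<eta> x1 X z.
        composite_problem d n f \<psi> G grad \<longrightarrow> n \<le> T \<longrightarrow> 2 * (n - 1) \<le> T \<longrightarrow> 0 < \<eta> \<longrightarrow>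
        x1 \<in> eff_dom d \<psi> \<longrightarrow> rr_iterates d n \<psi> grad T (\<lambda>t. \<eta>) x1 X \<longrightarrow> z \<in> Rd d \<longrightarrow>
        expectation_ereal (rr_pmf n (epoch n T))
          (\<lambda>\<pi>. objective n f \<psi> (suffix_avg n T (X \<pi>)) - objective n f \<psi> z)
        \<le> ereal (C * ((norm (z - x1))\<^sup>2 / (\<eta> * real T) +
             \<eta> * sqrt (real n) * G1 n G * G2 n G * (1 + ln (real T)))))
     \<and>
     (\<exists>C>0. \<forall>d n f \<psi> G grad T \<eta> x1 X z.
        composite_problem d n f \<psi> G grad \<longrightarrow> n \<le> T \<longrightarrow> 0 < \<eta> \<longrightarrow>
        x1 \<in> eff_dom d \<psi> \<longrightarrow> rr_iterates d n \<psi> grad T (\<lambda>t. \<eta> / sqrt (real t)) x1 X \<longrightarrow> z \<in> Rd d \<longrightarrow>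
        expectation_ereal (rr_pmf n (epoch n T))
          (\<lambda>\<pi>. objective n f \<psi> (suffix_avg n T (X \<pi>)) - objective n f \<psi> z)
        \<le> ereal (C * (((norm (z - x1))\<^sup>2 / \<eta> +
             \<eta> * sqrt (real n) * G1 n G * G2 n G * (1 + ln (real T))) * (1 / sqrt (real T)))))"
proof (intro conjI[OF exI[of _ "28::real"] exI[of _ "112::real"]] conjI allI impI)
qed (simp_all only: constant_step_bound inverse_sqrt_step_bound zero_less_numeral)

end
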